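(* Let $A\in M_n(\mathcal F)$ be strongly nonsingular (i.e. $A^m$ is nonsingular for all $m\in\mathbb N$), and write the characteristic polynomial, as a function, as a product $f_A=\prod_{i=1}^u g_i$ of primary factors $g_i=(x+\lambda_i)^{t_i}$ with $\lambda_1,\dots,\lambda_u$ distinct. For each $i$ set $V'_{\lambda_i}=\big(\prod_{j\ne i}g_j(A)\big)V$, where $V=\mathcal F^n$. Then the subspaces $V'_{\lambda_1},\dots,V'_{\lambda_u}$ are supertropically independent.
   Context: $\mathcal F=\mathcal T\cup\mathcal G\cup\{0_{\mathcal F}\}$ is the standard supertropical semifield: $\mathcal T$ is an ordered abelian group of tangible elements (written multiplicatively), $\mathcal G$ its ghost copy via $a\mapsto a^\nu$, $0_{\mathcal F}=-\infty$; $a+b$ is the element of larger $\nu$-value if these differ and $a+b=a^\nu$ if $a^\nu=b^\nu$; products multiply $\nu$-values and are tangible iff all factors are. $\det(A)=\sum_{\sigma\in S_n}\prod_ia_{i,\sigma(i)}$, $A$ nonsingular means $\det(A)\in\mathcal T$. The characteristic polynomial is $f_A(x)=\det(xI+A)$; a polynomial is $r$-primary if it has the unique root $r$ (root: $f(r)\in\mathcal G\cup\{0_{\mathcal F}\}$), and as a function the essential part of $f_A$ factors as a product of primary polynomials $(x+r_i)^{m_i}$. Vectors $w_1,\dots,w_k$ are supertropically dependent if there are $a_1,\dots,a_k\in\mathcal T$ with every coordinate of $\sum a_iw_i$ in $\mathcal G\cup\{0_{\mathcal F}\}$. Subspaces $V_1,\dots,V_k$ of $\mathcal F^n$ are dependent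 if there are tangible $w_i\in V_i$ which are dependent, and independent otherwise. *)

theory Defs
  imports "HOL-Combinatorics.Permutations"
begin

text \<open>The ordered abelian group of tangible elements T is written additively
(logarithmic notation) via the type class linordered_ab_group_add:
the tangible product a*b corresponds to a + b here, the tangible unit to 0.
Elements of F: the zero -infinity (Zero), tangible elements Tan a, ghosts Gh a = (Tan a)^nu.\<close>

datatype 'a st = Zero | Tan 'a | Gh 'a

fun st_plus :: "'a::linorder st \<Rightarrow> 'a st \<Rightarrow> 'a st" where
  "st_plus Zero y = y"
| "st_plus x Zero = x"
| "st_plus (Tan a) (Tan b) = (if a < b then Tan b else if b < a then Tan a else Gh a)"
| "st_plus (Tan a) (Gh b) = (if b < a then Tan a else Gh b)"
| "st_plus (Gh a) (Tan b) = (if a < b then Tan b else Gh a)"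
| "st_plus (Gh a) (Gh b) = Gh (max a b)"

fun st_times :: "'a::linordered_ab_group_add st \<Rightarrow> 'a st \<Rightarrow> 'a st" where
  "st_times Zero y = Zero"
| "st_times x Zero = Zero"
| "st_times (Tan a) (Tan b) = Tan (a + b)"
| "st_times (Tan a) (Gh b) = Gh (a + b)"
| "st_times (Gh a) (Tan b) = Gh (a + b)"
| "st_times (Gh a) (Gh b) = Gh (a + b)"

instantiation st :: (linordered_ab_group_add) comm_semiring_1
begin
definition zero_st_def: "0 = Zero"
definition one_st_def: "1 = Tan 0"
definition plus_st_def: "x + y = st_plus x y"
definition times_st_def: "x * y = st_times x y"
instance
proof
  fix a b c :: "'a st"
  show "a + b + c = a + (b + c)"
    unfolding plus_st_def
    by (cases a; cases b; cases c) (auto simp: max_def)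
  show "a + b = b + a"
    unfolding plus_st_def
    by (cases a; cases b) (auto simp: max_def)
  show "0 + a = a" unfolding plus_st_def zero_st_def by simp
  show "a * b * c = a * (b * c)"
    unfolding times_st_def
    by (cases a; cases b; cases c) (auto simp: add.assoc)
  show "a * b = b * a"
    unfolding times_st_def
    by (cases a; cases b) (auto simp: add.commute)
  show "1 * a = a" unfolding times_st_def one_st_def by (cases a) auto
  show "0 * a = 0" unfolding times_st_def zero_st_def by simp
  show "a * 0 = 0" unfolding times_st_def zero_st_def by (cases a) auto
  show "(0::'a st) \<noteq> 1" unfolding zero_st_def one_st_def by simp
  show "(a + b) * c = a * c + b * c"
    unfolding times_st_def plus_st_def
    by (cases a; cases b; cases c) (auto simp: max_def)
qed
end

definition tangible :: "'a st \<Rightarrow> bool" where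
  "tangible x \<longleftrightarrow> (\<exists>a. x = Tan a)"

definition ghost_or_zero :: "'a st \<Rightarrow> bool" where
  "ghost_or_zero x \<longleftrightarrow> x = Zero \<or> (\<exists>a. x = Gh a)"

type_synonym ('a, 'n) smat = "'n \<Rightarrow> 'n \<Rightarrow> 'a st"
type_synonym ('a, 'n) svec = "'n \<Rightarrow> 'a st"

definition smat_mult :: "('a::linordered_ab_group_add, 'n::finite) smat \<Rightarrow> ('a, 'n) smat \<Rightarrow> ('a, 'n) smat" where
  "smat_mult A B = (\<lambda>i j. \<Sum>k\<in>UNIV. A i k * B k j)"

definition smat_id :: "('a::linordered_ab_group_add, 'n::finite) smat" where
  "smat_id = (\<lambda>i j. if i = j then 1 else 0)"

definition smat_add :: "('a::linordered_ab_group_add, 'n::finite) smat \<Rightarrow> ('a, 'n) smat \<Rightarrow> ('a, 'n) smat" where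
  "smat_add A B = (\<lambda>i j. A i j + B i j)"

definition smat_scal :: "'a::linordered_ab_group_add st \<Rightarrow> ('a, 'n::finite) smat" where
  "smat_scal c = (\<lambda>i j. if i = j then c else 0)"

primrec smat_pow :: "('a::linordered_ab_group_add, 'n::finite) smat \<Rightarrow> nat \<Rightarrow> ('a, 'n) smat" where
  "smat_pow A 0 = smat_id"
| "smat_pow A (Suc m) = smat_mult (smat_pow A m) A"

definition smat_vec :: "('a::linordered_ab_group_add, 'n::finite) smat \<Rightarrow> ('a, 'n) svec \<Rightarrow> ('a, 'n) svec" where
  "smat_vec A v = (\<lambda>i. \<Sum>k\<in>UNIV. A i k * v k)"

definition smat_prod_list :: "('a::linordered_ab_group_add, 'n::finite) smat list \<Rightarrow> ('a, 'n) smat" where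
  "smat_prod_list Ms = foldr smat_mult Ms smat_id"

definition sdet :: "('a::linordered_ab_group_add, 'n::finite) smat \<Rightarrow> 'a st" where
  "sdet A = (\<Sum>\<sigma> | \<sigma> permutes (UNIV::'n set). \<Prod>i\<in>UNIV. A i (\<sigma> i))"

definition nonsingular :: "('a::linordered_ab_group_add, 'n::finite) smat \<Rightarrow> bool" where
  "nonsingular A \<longleftrightarrow> tangible (sdet A)"

definition strongly_nonsingular :: "('a::linordered_ab_group_add, 'n::finite) smat \<Rightarrow> bool" where
  "strongly_nonsingular A \<longleftrightarrow> (\<forall>m. nonsingular (smat_pow A m))"

definition charpoly_fun :: "('a::linordered_ab_group_add, 'n::finite) smat \<Rightarrow> 'a st \<Rightarrow> 'a st" where
  "charpoly_fun A x = sdet (smat_add (smat_scal x) A)"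

definition primary_at :: "('a::linordered_ab_group_add, 'n::finite) smat \<Rightarrow> 'a st \<Rightarrow> nat \<Rightarrow> ('a, 'n) smat" where
  "primary_at A lam t = smat_pow (smat_add A (smat_scal lam)) t"

definition smat_image :: "('a::linordered_ab_group_add, 'n::finite) smat \<Rightarrow> ('a, 'n) svec set" where
  "smat_image M = range (smat_vec M)"

definition tangible_vec :: "('a, 'n) svec \<Rightarrow> bool" where
  "tangible_vec w \<longleftrightarrow> (\<forall>k. tangible (w k) \<or> w k = Zero) \<and> (\<exists>k. w k \<noteq> Zero)"

definition st_dependent_vecs :: "nat \<Rightarrow> (nat \<Rightarrow> ('a::linordered_ab_group_add, 'n::finite) svec) \<Rightarrow> bool" where
  "st_dependent_vecs k w \<longleftrightarrow>
     (\<exists>a. (\<forall>i<k. tangible (a i)) \<and> (\<forall>c. ghost_or_zero (\<Sum>i<k. a i * w i c)))"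

definition st_dependent_subspaces :: "nat \<Rightarrow> (nat \<Rightarrow> ('a::linordered_ab_group_add, 'n::finite) svec set) \<Rightarrow> bool" where
  "st_dependent_subspaces k V \<longleftrightarrow>
     (\<exists>w. (\<forall>i<k. tangible_vec (w i) \<and> w i \<in> V i) \<and> st_dependent_vecs k w)"

definition st_independent_subspaces :: "nat \<Rightarrow> (nat \<Rightarrow> ('a::linordered_ab_group_add, 'n::finite) svec set) \<Rightarrow> bool" where
  "st_independent_subspaces k V \<longleftrightarrow> \<not> st_dependent_subspaces k V"

end

theory Submission
  imports Defs "HOL-Combinatorics.Cycles"
begin

text \<open>
Let \<open>\<sigma>\<close> be the optimal permutation of \<open>A\<close>. Nonsingularity of all powers forces \<open>det (A\<^sup>m) = (det A)\<^sup>m\<close>,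
so whenever \<open>\<sigma>\<^sup>m = id\<close> the diagonal of \<open>A\<^sup>m\<close> is attained only by walking along \<open>\<sigma>\<close>. Hence every
closed walk that leaves \<open>\<sigma>\<close> weighs less than the means \<open>\<mu>\<close> of the \<open>\<sigma>\<close>-cycles it meets, and after
a diagonal similarity row \<open>j\<close> of \<open>A\<close> has the entry \<open>\<mu>\<^sub>j\<close> at \<open>\<sigma> j\<close> and smaller entries elsewhere.
The characteristic polynomial is then the product of \<open>x\<^bsup>|C|\<^esup> + w(C)\<close> over the \<open>\<sigma>\<close>-cycles \<open>C\<close> of
weight \<open>w(C)\<close>, so the roots \<open>\<lambda>\<^sub>k\<close> are the cycle means \<open>\<mu>\<^sub>j\<close>, up to rounding \<open>\<mu>\<^sub>j\<close> to adjacent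
elements when the value group is not divisible.

Suppose tangible vectors \<open>z\<^sub>i \<in> V'\<^sub>i\<close> sum to a ghost and take a coordinate \<open>j\<close> where the largest
normalised entry of all \<open>z\<^sub>i\<close> occurs. It is attained by two of the vectors, so by some \<open>z\<^sub>i\<close> whose
definition contains the factor \<open>(A + \<lambda>\<^sub>k)\<^sup>t\<close> belonging to \<open>\<mu>\<^sub>j\<close>. On the cycle of \<open>j\<close> the summands
\<open>A\<close> and \<open>\<lambda>\<^sub>k\<close> of this factor then balance and turn an entry of \<open>z\<^sub>i\<close> into a ghost.
\<close>

section \<open>Multiples in an ordered abelian group\<close>

text \<open>The value group need not be divisible, so cycle means are compared through multiples.
  Writing a multiple as a constant sum makes the lemmas on \<open>sum\<close> apply.\<close>

definition nmul :: "nat \<Rightarrow> 'a::comm_monoid_add \<Rightarrow> 'a" where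
  "nmul n x = (\<Sum>_<n. x)"

lemma nmul_0 [simp]: "nmul 0 x = 0" by (simp add: nmul_def)
lemma nmul_Suc [simp]: "nmul (Suc n) x = x + nmul n x" by (simp add: nmul_def add.commute)
lemma nmul_add: "nmul n (x + y) = nmul n x + nmul n y" by (simp add: nmul_def sum.distrib)
lemma nmul_diff: "nmul n (x - y) = nmul n x - nmul n (y::'a::ab_group_add)"
  by (simp add: nmul_def sum_subtractf)
lemma nmul_sum: "nmul n (sum f S) = (\<Sum>i\<in>S. nmul n (f i))"
  unfolding nmul_def by (rule sum.swap)
lemma nmul_add_left: "nmul (m + n) x = nmul m x + nmul n x"
  by (induction m) (simp_all add: add.assoc)
lemma nmul_mult: "nmul (m * n) x = nmul m (nmul n x)"
  by (induction m) (simp_all add: nmul_add_left)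
lemma sum_const_nmul: "finite S \<Longrightarrow> (\<Sum>_\<in>S. x) = nmul (card S) x"
  by (induction S rule: finite_induct) simp_all
lemma nmul_zero [simp]: "nmul n 0 = 0" by (simp add: nmul_def)
lemma sum_nmul_left: "finite S \<Longrightarrow> (\<Sum>i\<in>S. nmul (f i) x) = nmul (\<Sum>i\<in>S. f i) x"
  by (induction S rule: finite_induct) (simp_all add: nmul_add_left)

lemma nmul_mono: "x \<le> y \<Longrightarrow> nmul n x \<le> nmul n (y::'a::linordered_ab_group_add)"
  unfolding nmul_def by (rule sum_mono)
lemma nmul_strict_mono: "x < y \<Longrightarrow> 0 < n \<Longrightarrow> nmul n x < nmul n (y::'a::linordered_ab_group_add)"
  unfolding nmul_def by (rule sum_strict_mono) auto
lemma nmul_le_iff: "0 < n \<Longrightarrow> nmul n x \<le> nmul n y \<longleftrightarrow> x \<le> (y::'a::linordered_ab_group_add)"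
  by (meson linorder_not_le nmul_mono nmul_strict_mono)
lemma nmul_less_iff: "0 < n \<Longrightarrow> nmul n x < nmul n y \<longleftrightarrow> x < (y::'a::linordered_ab_group_add)"
  by (meson linorder_not_le nmul_mono nmul_strict_mono)
lemma nmul_eq_iff: "0 < n \<Longrightarrow> nmul n x = nmul n y \<longleftrightarrow> x = (y::'a::linordered_ab_group_add)"
  by (metis nmul_less_iff linorder_neq_iff)
lemma nmul_max: "nmul n (max x y) = max (nmul n x) (nmul n (y::'a::linordered_ab_group_add))"
  by (metis max.absorb1 max.absorb2 linorder_linear nmul_mono)
lemma nmul_nonneg: "0 \<le> x \<Longrightarrow> 0 \<le> nmul n (x::'a::linordered_ab_group_add)"
  using nmul_mono[of 0 x n] by simp
lemma nmul_pos: "0 < x \<Longrightarrow> 0 < n \<Longrightarrow> 0 < nmul n (x::'a::linordered_ab_group_add)"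
  using nmul_strict_mono[of 0 x n] by simp
lemma nmul_left_mono: "m \<le> n \<Longrightarrow> 0 \<le> x \<Longrightarrow> nmul m x \<le> nmul n (x::'a::linordered_ab_group_add)"
  by (metis le_add_diff_inverse nmul_add_left nmul_nonneg le_add_same_cancel1)
lemma nmul_left_strict_mono: "m < n \<Longrightarrow> 0 < x \<Longrightarrow> nmul m x < nmul n (x::'a::linordered_ab_group_add)"
  by (metis add_diff_inverse_nat less_add_same_cancel1 nmul_add_left nmul_pos not_less_iff_gr_or_eq zero_less_diff)

section \<open>Tangible sums and products\<close>

text \<open>The value at \<open>Zero\<close> is a placeholder for -infinity, which the group does
  not contain; hence the nonvanishing hypotheses that accompany \<open>val\<close>.\<close>

fun val :: "'a::zero st \<Rightarrow> 'a" where
  "val Zero = 0"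
| "val (Tan a) = a"
| "val (Gh a) = a"

lemma Zero_eq_0: "Zero = 0" by (simp add: zero_st_def)

lemma ghost_or_zero_iff: "ghost_or_zero x \<longleftrightarrow> \<not> tangible x"
  by (cases x) (auto simp: ghost_or_zero_def tangible_def)

lemma tangible_Tan [simp]: "tangible (Tan a)" by (simp add: tangible_def)
lemma not_tangible_0 [simp]: "\<not> tangible 0" by (simp add: tangible_def zero_st_def)
lemma tangible_1 [simp]: "tangible 1" by (simp add: one_st_def)
lemma val_1 [simp]: "val 1 = 0" by (simp add: one_st_def)
lemma tangible_nonzero: "tangible x \<Longrightarrow> x \<noteq> 0" by auto
lemma tangible_Tan_val: "tangible x \<Longrightarrow> Tan (val x) = x" by (auto simp: tangible_def)
lemma Tan_nonzero [simp]: "Tan a \<noteq> 0" by (simp add: zero_st_def)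

lemma st_mult_eq_0 [simp]: "x * y = 0 \<longleftrightarrow> x = 0 \<or> y = (0::'a::linordered_ab_group_add st)"
  unfolding zero_st_def times_st_def by (cases x; cases y) auto

lemma val_mult: "x \<noteq> 0 \<Longrightarrow> y \<noteq> 0 \<Longrightarrow> val (x * y) = val x + val (y::'a::linordered_ab_group_add st)"
  unfolding zero_st_def times_st_def by (cases x; cases y) auto

lemma tangible_mult [simp]: "tangible (x * y) \<longleftrightarrow> tangible x \<and> tangible (y::'a::linordered_ab_group_add st)"
  unfolding tangible_def times_st_def by (cases x; cases y) auto

lemma st_add_eq_0 [simp]: "x + y = 0 \<longleftrightarrow> x = 0 \<and> y = (0::'a::linordered_ab_group_add st)"
  unfolding zero_st_def plus_st_def by (cases x; cases y) auto

lemma val_add: "x \<noteq> 0 \<Longrightarrow> y \<noteq> 0 \<Longrightarrow> val (x + y) = max (val x) (val (y::'a::linordered_ab_group_add st))"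
  unfolding zero_st_def plus_st_def by (cases x; cases y) auto

lemma tangible_add:
  "x \<noteq> 0 \<Longrightarrow> y \<noteq> 0 \<Longrightarrow> tangible (x + y) \<longleftrightarrow>
     tangible x \<and> val y < val x \<or> tangible y \<and> val x < val (y::'a::linordered_ab_group_add st)"
  unfolding zero_st_def plus_st_def tangible_def by (cases x; cases y) auto

lemma val_add_ge: "x \<noteq> 0 \<Longrightarrow> val x \<le> val (x + (y::'a::linordered_ab_group_add st))"
  by (cases "y = 0") (auto simp: val_add)

lemma st_prod_eq_0: "finite S \<Longrightarrow> prod f S = 0 \<longleftrightarrow> (\<exists>i\<in>S. f i = (0::'a::linordered_ab_group_add st))"
  by (induction S rule: finite_induct) auto

lemma val_prod:
  "finite S \<Longrightarrow> (\<And>i. i \<in> S \<Longrightarrow> f i \<noteq> 0) \<Longrightarrow> val (prod f S) = (\<Sum>i\<in>S. val (f i :: 'a::linordered_ab_group_add st))"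
  by (induction S rule: finite_induct) (auto simp: val_mult st_prod_eq_0)

lemma tangible_prod: "finite S \<Longrightarrow> tangible (prod f S) \<longleftrightarrow> (\<forall>i\<in>S. tangible (f i :: 'a::linordered_ab_group_add st))"
  by (induction S rule: finite_induct) auto

lemma st_pow_eq_0: "x ^ n = 0 \<longleftrightarrow> n > 0 \<and> x = (0::'a::linordered_ab_group_add st)"
  by (induction n) auto
lemma val_pow: "x \<noteq> 0 \<Longrightarrow> val (x ^ n) = nmul n (val (x::'a::linordered_ab_group_add st))"
  by (induction n) (auto simp: val_mult st_pow_eq_0)
lemma tangible_pow: "tangible (x ^ n) \<longleftrightarrow> n = 0 \<or> tangible (x::'a::linordered_ab_group_add st)"
  by (induction n) auto

lemma st_sum_eq_0: "finite S \<Longrightarrow> sum f S = 0 \<longleftrightarrow> (\<forall>i\<in>S. f i = (0::'a::linordered_ab_group_add st))"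
  by (induction S rule: finite_induct) auto

lemma val_sum_ge:
  fixes f :: "'b \<Rightarrow> 'a::linordered_ab_group_add st"
  assumes "finite S" "i \<in> S" "f i \<noteq> 0"
  shows "sum f S \<noteq> 0" "val (f i) \<le> val (sum f S)"
proof -
  show "sum f S \<noteq> 0" using assms by (auto simp: st_sum_eq_0)
  show "val (f i) \<le> val (sum f S)"
    using assms val_add_ge[of "f i" "sum f (S - {i})"] by (simp add: sum.remove)
qed

lemma sum_attained:
  fixes f :: "'b \<Rightarrow> 'a::linordered_ab_group_add st"
  assumes "finite S" "sum f S \<noteq> 0"
  shows "\<exists>i\<in>S. f i \<noteq> 0 \<and> val (f i) = val (sum f S)"
  using assms
proof (induction S rule: finite_induct)
  case (insert x F)
  show ?case
  proof (cases "f x = 0 \<or> sum f F = 0")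
    case True with insert show ?thesis by auto
  next
    case False
    with insert show ?thesis by (auto simp: val_add max_def)
  qed
qed simp

text \<open>If the maximal value were attained twice, or by a ghost, the sum would be a ghost. The
  proof compares \<open>f i\<close> with the sum \<open>r\<close> of all other terms.\<close>

lemma tangible_sum_term:
  fixes f :: "'b \<Rightarrow> 'a::linordered_ab_group_add st"
  assumes "finite S" "tangible (sum f S)" "i \<in> S" "f i \<noteq> 0" "val (f i) = val (sum f S)"
  shows "tangible (f i)" "\<And>j. j \<in> S \<Longrightarrow> j \<noteq> i \<Longrightarrow> f j \<noteq> 0 \<Longrightarrow> val (f j) < val (f i)"
proof -
  define r where "r = sum f (S - {i})"
  have "sum f S = f i + r" using assms by (simp add: sum.remove r_def)
  with assms have t: "tangible (f i + r)" "val (f i + r) = val (f i)" by simp_all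
  have r: "tangible (f i) \<and> val r < val (f i)" if "r \<noteq> 0"
    using t that assms(4) tangible_add[of "f i" r] val_add[of "f i" r] by (auto simp: max_def split: if_splits)
  show "tangible (f i)" using t r by (cases "r = 0") auto
  fix j assume j: "j \<in> S" "j \<noteq> i" "f j \<noteq> 0"
  then have "r \<noteq> 0" "val (f j) \<le> val r"
    using assms(1) val_sum_ge[of "S - {i}" j f] by (auto simp: r_def)
  with r show "val (f j) < val (f i)" by auto
qed

lemma tangible_sumI:
  fixes f :: "'b \<Rightarrow> 'a::linordered_ab_group_add st"
  assumes "finite S" "i \<in> S" "tangible (f i)"
    and "\<And>j. j \<in> S \<Longrightarrow> j \<noteq> i \<Longrightarrow> f j \<noteq> 0 \<Longrightarrow> val (f j) < val (f i)"
  shows "tangible (sum f S)"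
proof -
  have eq: "sum f S = f i + sum f (S - {i})" using assms by (simp add: sum.remove)
  show ?thesis
  proof (cases "sum f (S - {i}) = 0")
    case False
    then obtain j where "j \<in> S - {i}" "f j \<noteq> 0" "val (f j) = val (sum f (S - {i}))"
      using sum_attained[of "S - {i}" f] assms(1) by auto
    with assms(4)[of j] have "val (sum f (S - {i})) < val (f i)" by auto
    with assms(3) False eq show ?thesis by (simp add: tangible_add tangible_nonzero)
  qed (use assms eq in auto)
qed

section \<open>Determinants of products and powers\<close>

lemma val_smat_mult_ge:
  fixes X Y :: "('a::linordered_ab_group_add, 'n::finite) smat"
  assumes "X i k \<noteq> 0" "Y k j \<noteq> 0"
  shows "smat_mult X Y i j \<noteq> 0" "val (X i k) + val (Y k j) \<le> val (smat_mult X Y i j)"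
  using val_sum_ge[of UNIV k "\<lambda>k. X i k * Y k j"] assms
  by (auto simp: smat_mult_def val_mult)

lemma sdet_term_ge:
  fixes X :: "('a::linordered_ab_group_add, 'n::finite) smat"
  assumes "p permutes UNIV" "\<And>i. X i (p i) \<noteq> 0"
  shows "sdet X \<noteq> 0" "(\<Sum>i\<in>UNIV. val (X i (p i))) \<le> val (sdet X)"
  using val_sum_ge[of "{p. p permutes (UNIV::'n set)}" p "\<lambda>p. \<Prod>i\<in>UNIV. X i (p i)"] assms
  by (auto simp: sdet_def val_prod st_prod_eq_0 finite_permutations)

lemma sdet_attained:
  fixes X :: "('a::linordered_ab_group_add, 'n::finite) smat"
  assumes "sdet X \<noteq> 0"
  shows "\<exists>p. p permutes UNIV \<and> (\<forall>i. X i (p i) \<noteq> 0) \<and> (\<Sum>i\<in>UNIV. val (X i (p i))) = val (sdet X)"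
  using sum_attained[of "{p. p permutes (UNIV::'n set)}" "\<lambda>p. \<Prod>i\<in>UNIV. X i (p i)"] assms
  by (auto simp: sdet_def val_prod st_prod_eq_0 finite_permutations)

lemma tangible_sdet_term:
  fixes X :: "('a::linordered_ab_group_add, 'n::finite) smat"
  assumes "tangible (sdet X)" "p permutes UNIV" "\<And>i. X i (p i) \<noteq> 0"
    "(\<Sum>i\<in>UNIV. val (X i (p i))) = val (sdet X)"
  shows "tangible (X i (p i))"
    "\<And>q. q permutes UNIV \<Longrightarrow> q \<noteq> p \<Longrightarrow> (\<And>i. X i (q i) \<noteq> 0) \<Longrightarrow>
       (\<Sum>i\<in>UNIV. val (X i (q i))) < val (sdet X)"
proof -
  let ?P = "{p. p permutes (UNIV::'n set)}" and ?f = "\<lambda>p. \<Prod>i\<in>UNIV. X i (p i)"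
  have 0: "finite ?P" "tangible (sum ?f ?P)" "p \<in> ?P" "?f p \<noteq> 0" "val (?f p) = val (sum ?f ?P)"
    using assms by (simp_all add: sdet_def finite_permutations val_prod st_prod_eq_0)
  show "tangible (X i (p i))"
    using tangible_sum_term(1)[OF 0] by (simp add: tangible_prod)
  fix q :: "'n \<Rightarrow> 'n" assume q: "q permutes UNIV" "q \<noteq> p" "\<And>i. X i (q i) \<noteq> 0"
  then have "val (?f q) < val (?f p)"
    by (intro tangible_sum_term(2)[OF 0]) (auto simp: st_prod_eq_0)
  then show "(\<Sum>i\<in>UNIV. val (X i (q i))) < val (sdet X)"
    using assms q by (simp add: val_prod)
qed

text \<open>An optimal permutation of the product chooses an intermediate index \<open>g i\<close>
  in each row. Tangibility of the determinant forces \<open>g\<close> to be a bijection, and the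
  optimal term then splits into one term of each of the two determinants.\<close>

lemma sdet_mult_le:
  fixes X Y :: "('a::linordered_ab_group_add, 'n::finite) smat"
  assumes "tangible (sdet (smat_mult X Y))"
  shows "sdet X \<noteq> 0 \<and> sdet Y \<noteq> 0 \<and> val (sdet (smat_mult X Y)) \<le> val (sdet X) + val (sdet Y)"
proof -
  let ?Z = "smat_mult X Y"
  obtain p where p: "p permutes UNIV" "\<And>i. ?Z i (p i) \<noteq> 0"
    "(\<Sum>i\<in>UNIV. val (?Z i (p i))) = val (sdet ?Z)"
    using sdet_attained[OF tangible_nonzero[OF assms]] by blast
  have "\<exists>k. X i k \<noteq> 0 \<and> Y k (p i) \<noteq> 0 \<and> val (X i k) + val (Y k (p i)) = val (?Z i (p i))" for i
    using sum_attained[of UNIV "\<lambda>k. X i k * Y k (p i)"] p(2)[of i]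
    by (auto simp: smat_mult_def) (metis val_mult)
  then obtain g where g: "\<And>i. X i (g i) \<noteq> 0" "\<And>i. Y (g i) (p i) \<noteq> 0"
    "\<And>i. val (X i (g i)) + val (Y (g i) (p i)) = val (?Z i (p i))" by metis
  have tot: "(\<Sum>i\<in>UNIV. val (X i (g i))) + (\<Sum>i\<in>UNIV. val (Y (g i) (p i))) = val (sdet ?Z)"
    by (simp add: sum.distrib[symmetric] g(3) p(3))
  \<comment> \<open>If two rows used the same intermediate index, exchanging their tails would give a second
    optimal permutation.\<close>
  have "inj g"
  proof (rule injI, rule ccontr)
    fix a b assume ab: "g a = g b" "a \<noteq> b"
    let ?t = "transpose a b" and ?q = "p \<circ> transpose a b"
    have t: "?t permutes UNIV" by (simp add: permutes_swap_id)
    have q: "?q permutes UNIV" using permutes_compose[OF t p(1)] .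
    have gt: "g (?t i) = g i" for i using ab by (auto simp: transpose_def)
    have Yq: "Y (g i) (?q i) \<noteq> 0" for i using g(2)[of "?t i"] gt by simp
    have qne: "?q \<noteq> p"
    proof
      assume "?q = p"
      then have "p (?t a) = p a" by (metis comp_apply)
      then have "p b = p a" by simp
      then show False using permutes_inj[OF p(1)] ab(2) by (auto dest: injD)
    qed
    have Zq: "?Z i (?q i) \<noteq> 0" "val (X i (g i)) + val (Y (g i) (?q i)) \<le> val (?Z i (?q i))" for i
      using val_smat_mult_ge[of X i "g i" Y, OF g(1) Yq] by auto
    have "(\<Sum>i\<in>UNIV. val (Y (g i) (p i))) = (\<Sum>i\<in>UNIV. val (Y (g (?t i)) (p (?t i))))"
      using sum.permute[OF t, of "\<lambda>i. val (Y (g i) (p i))"] by (simp add: comp_def)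
    then have "val (sdet ?Z) = (\<Sum>i\<in>UNIV. val (X i (g i)) + val (Y (g i) (?q i)))"
      using tot by (simp add: gt sum.distrib)
    also have "\<dots> \<le> (\<Sum>i\<in>UNIV. val (?Z i (?q i)))" by (intro sum_mono Zq(2))
    also have "\<dots> < val (sdet ?Z)"
      using tangible_sdet_term(2)[OF assms p q qne Zq(1)] .
    finally show False by simp
  qed
  then have gp: "g permutes UNIV" by (metis finite_UNIV inj_imp_permutes UNIV_I)
  have ig: "inv g permutes UNIV" using permutes_inv[OF gp] .
  have pg: "(p \<circ> inv g) permutes UNIV" using permutes_compose[OF ig p(1)] .
  have Yn: "Y k ((p \<circ> inv g) k) \<noteq> 0" for k
    using g(2)[of "inv g k"] permutes_inverses(1)[OF gp, of k] by (simp add: comp_def)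
  have "(\<Sum>i\<in>UNIV. val (Y (g i) (p i))) = (\<Sum>k\<in>UNIV. val (Y k ((p \<circ> inv g) k)))"
    using sum.permute[OF gp, of "\<lambda>k. val (Y k ((p \<circ> inv g) k))"]
    by (simp add: comp_def \<open>inj g\<close>)
  then have "val (sdet ?Z) \<le> val (sdet X) + val (sdet Y)"
    unfolding tot[symmetric]
    using add_mono[OF sdet_term_ge(2)[of g X, OF gp g(1)] sdet_term_ge(2)[of "p \<circ> inv g" Y, OF pg Yn]]
    by simp
  then show ?thesis
    using sdet_term_ge(1)[of g X, OF gp g(1)] sdet_term_ge(1)[of "p \<circ> inv g" Y, OF pg Yn] by blast
qed

lemma strongly_nonsingular_sdet: "strongly_nonsingular A \<Longrightarrow> tangible (sdet A)"
proof -
  assume "strongly_nonsingular A"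
  then have "tangible (sdet (smat_pow A 1))" by (simp only: strongly_nonsingular_def nonsingular_def)
  moreover have "smat_pow A 1 = A"
    by (auto simp: smat_mult_def smat_id_def fun_eq_iff if_distrib[of "\<lambda>x. x * _"] cong: if_cong)
  ultimately show ?thesis by simp
qed

text \<open>This is the half of det(A^m) = det(A)^m that rests on the powers being nonsingular. The
  other half is supplied by the walks along \<sigma> in \<open>smat_pow_diag\<close>.\<close>

lemma strongly_nonsingular_sdet_pow_le:
  assumes "strongly_nonsingular A"
  shows "val (sdet (smat_pow A m)) \<le> nmul m (val (sdet A))"
proof (induction m)
  case 0
  have t: "tangible (sdet (smat_pow A 0))" using assms by (simp add: strongly_nonsingular_def nonsingular_def del: smat_pow.simps)
  obtain p where p: "p permutes UNIV" "\<And>i. smat_pow A 0 i (p i) \<noteq> 0"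
    "(\<Sum>i\<in>UNIV. val (smat_pow A 0 i (p i))) = val (sdet (smat_pow A 0))"
    using sdet_attained[OF tangible_nonzero[OF t]] by blast
  have "p i = i" for i using p(2)[of i] by (auto simp: smat_id_def split: if_splits)
  with p(3) show ?case by (simp add: smat_id_def)
next
  case (Suc m)
  have "tangible (sdet (smat_pow A (Suc m)))"
    using assms by (simp add: strongly_nonsingular_def nonsingular_def del: smat_pow.simps)
  then have "val (sdet (smat_pow A (Suc m))) \<le> val (sdet (smat_pow A m)) + val (sdet A)"
    using sdet_mult_le[of "smat_pow A m" A] by simp
  also have "\<dots> \<le> nmul m (val (sdet A)) + val (sdet A)" using Suc by (rule add_right_mono)
  finally show ?case by (simp add: add.commute)
qed

section \<open>Walks and periodic sums\<close>

lemma smat_pow_walk_ge: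
  fixes A :: "('a::linordered_ab_group_add, 'n::finite) smat"
  assumes "\<And>s. s < m \<Longrightarrow> A (\<gamma> s) (\<gamma> (Suc s)) \<noteq> 0"
  shows "smat_pow A m (\<gamma> 0) (\<gamma> m) \<noteq> 0 \<and>
    (\<Sum>s<m. val (A (\<gamma> s) (\<gamma> (Suc s)))) \<le> val (smat_pow A m (\<gamma> 0) (\<gamma> m))"
  using assms
proof (induction m)
  case 0
  then show ?case by (simp add: smat_id_def)
next
  case (Suc m)
  then have IH: "smat_pow A m (\<gamma> 0) (\<gamma> m) \<noteq> 0"
    "(\<Sum>s<m. val (A (\<gamma> s) (\<gamma> (Suc s)))) \<le> val (smat_pow A m (\<gamma> 0) (\<gamma> m))" by auto
  have "A (\<gamma> m) (\<gamma> (Suc m)) \<noteq> 0" using Suc.prems by simp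
  note * = val_smat_mult_ge[of "smat_pow A m" "\<gamma> 0" "\<gamma> m" A "\<gamma> (Suc m)", OF IH(1) this]
  show ?case
    using *(1) order_trans[OF add_right_mono[OF IH(2)] *(2)] by simp
qed

lemma sum_lessThan_add: "(\<Sum>s<a + b. h s) = (\<Sum>s<a. h s) + (\<Sum>s<b. h (a + s))"
  for h :: "nat \<Rightarrow> 'a::comm_monoid_add"
  by (induction b) (simp_all add: add.assoc)

lemma periodic_add_mult:
  assumes "\<And>s. h (s + L) = h s"
  shows "h (s + n * L) = h (s::nat)"
proof (induction n)
  case (Suc n)
  have "h (s + Suc n * L) = h ((s + n * L) + L)" by (simp add: ac_simps)
  with Suc show ?case using assms by metis
qed simp

lemma sum_periodic:
  fixes h :: "nat \<Rightarrow> 'a::comm_monoid_add"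
  assumes "\<And>s. h (s + L) = h s"
  shows "(\<Sum>s<n * L. h s) = nmul n (\<Sum>s<L. h s)"
proof (induction n)
  case (Suc n)
  have "(\<Sum>s<n * L. h (L + s)) = (\<Sum>s<n * L. h s)"
    using assms by (simp add: add.commute)
  then show ?case using Suc by (simp add: sum_lessThan_add)
qed simp

lemma sum_periodic_shift:
  fixes h :: "nat \<Rightarrow> 'a::ab_group_add"
  assumes "\<And>s. h (s + L) = h s"
  shows "(\<Sum>s<L. h (s + q)) = (\<Sum>s<L. h s)"
proof (induction q)
  case (Suc q)
  have "(\<Sum>s<Suc L. h (s + q)) = h q + (\<Sum>s<L. h (s + Suc q))"
    by (subst sum.lessThan_Suc_shift) simp
  moreover have "h (L + q) = h q" using assms[of q] by (simp add: add.commute)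
  ultimately show ?case using Suc by simp
qed simp

section \<open>Potentials\<close>

fun path_weight :: "('n \<Rightarrow> 'n \<Rightarrow> 'a::comm_monoid_add) \<Rightarrow> 'n list \<Rightarrow> 'a" where
  "path_weight c (x # y # zs) = c x y + path_weight c (y # zs)"
| "path_weight c _ = 0"

lemma path_weight_append: "path_weight c (as @ x # bs) = path_weight c (as @ [x]) + path_weight c (x # bs)"
proof (induction as)
  case Nil
  then show ?case by simp
next
  case (Cons a as)
  then show ?case by (cases as) (simp_all add: add.assoc)
qed

lemma path_weight_conv_nth: "path_weight c (x # zs) = (\<Sum>s<length zs. c ((x # zs) ! s) (zs ! s))"
proof (induction zs arbitrary: x)
  case (Cons z zs)
  show ?case
    by (simp add: Cons sum.lessThan_Suc_shift del: sum.lessThan_Suc)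
qed simp

text \<open>The potential \<open>y j\<close> is the largest weight of a simple path starting at
  \<open>j\<close>; simplicity makes the maximum finite. Prepending an edge either gives a simple
  path again or closes a cycle, which can be cut off because its weight is at most 0.\<close>

lemma potential_exists:
  fixes E :: "'n::finite \<Rightarrow> 'n \<Rightarrow> bool" and c :: "'n \<Rightarrow> 'n \<Rightarrow> 'a::linordered_ab_group_add"
  assumes cyc: "\<And>xs. xs \<noteq> [] \<Longrightarrow> distinct xs \<Longrightarrow>
      (\<And>s. s < length xs \<Longrightarrow> E (xs ! s) (xs ! (Suc s mod length xs))) \<Longrightarrow>
      (\<Sum>s<length xs. c (xs ! s) (xs ! (Suc s mod length xs))) \<le> 0"
  shows "\<exists>y. \<forall>j k. E j k \<longrightarrow> c j k + y k \<le> y j"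
proof -
  define P where "P j = {xs. distinct xs \<and> xs \<noteq> [] \<and> hd xs = j \<and> successively E xs}" for j
  define y where "y j = Max (path_weight c ` P j)" for j
  have "finite {xs::'n list. distinct xs}"
    using finite_subset_distinct[of "UNIV::'n set"] by simp
  then have fin: "finite (path_weight c ` P j)" for j
    by (rule finite_imageI[OF finite_subset[rotated]]) (auto simp: P_def)
  have "[j] \<in> P j" for j by (simp add: P_def)
  then have ne: "path_weight c ` P j \<noteq> {}" for j by blast
  have ge: "path_weight c xs \<le> y j" if "xs \<in> P j" for xs j
    using that fin by (auto simp: y_def)
  have "c j k + y k \<le> y j" if E: "E j k" for j k
  proof -
    obtain xs where xs: "xs \<in> P k" "path_weight c xs = y k"
      using Max_in[OF fin ne, of k] unfolding y_def by force
    then obtain zs where zs: "xs = k # zs" by (cases xs) (auto simp: P_def)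
    show ?thesis
    proof (cases "j \<in> set xs")
      case False
      then have "j # xs \<in> P j" using xs E zs by (auto simp: P_def)
      from ge[OF this] show ?thesis using xs zs by simp
    next
      case True
      then obtain ps qs where split: "xs = ps @ j # qs" "j \<notin> set ps" by (meson split_list_first)
      have "j # qs \<in> P j" using xs split by (auto simp: P_def successively_append_iff)
      then have q: "path_weight c (j # qs) \<le> y j" by (rule ge)
      \<comment> \<open>\<open>j # ps\<close> is the cycle closed by the new edge, and
        \<open>ps @ [j]\<close> is its part from \<open>k\<close> back to \<open>j\<close>. For
        empty \<open>ps\<close> one has \<open>j = k\<close> and the cycle is a loop.\<close>
      have hd: "ps @ [j] = k # tl (ps @ [j])" using split zs by (cases ps) auto
      have suc: "successively E (j # ps @ [j])"
      proof -
        have "successively E (ps @ [j])" using xs split by (auto simp: P_def successively_append_iff)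
        then show ?thesis using hd E by (metis successively.simps(3))
      qed
      let ?c = "j # ps"
      have nth: "?c ! (Suc s mod length ?c) = (ps @ [j]) ! s" if "s < length ?c" for s
        using that by (cases "s = length ps") (auto simp: nth_append)
      have nth': "(?c @ [j]) ! s = ?c ! s" if "s < length ?c" for s
        using that by (simp add: nth_append del: append_Cons)
      have Ec: "E (?c ! s) (?c ! (Suc s mod length ?c))" if "s < length ?c" for s
      proof -
        have "E ((j # ps @ [j]) ! s) ((j # ps @ [j]) ! Suc s)"
          using suc that by (auto simp: successively_conv_nth)
        then show ?thesis using nth[OF that] nth'[OF that] by simp
      qed
      have "path_weight c (j # ps @ [j]) = (\<Sum>s<length ?c. c (?c ! s) (?c ! (Suc s mod length ?c)))"
        unfolding path_weight_conv_nth
        by (rule sum.cong) (use nth nth' in auto)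
      also have "\<dots> \<le> 0"
        by (rule cyc) (use xs split Ec in \<open>auto simp: P_def\<close>)
      finally have "c j k + path_weight c (ps @ [j]) \<le> 0"
        by (subst (asm) hd, subst hd) simp
      from add_mono[OF this q] show ?thesis
        using xs(2) split path_weight_append[of c ps j qs] by (simp add: add.assoc)
    qed
  qed
  then show ?thesis by blast
qed

section \<open>Closed walks\<close>

locale optimal_permutation =
  fixes A :: "('a::linordered_ab_group_add, 'n::finite) smat" and \<sigma> :: "'n \<Rightarrow> 'n"
  assumes sn: "strongly_nonsingular A"
    and perm: "\<sigma> permutes UNIV"
    and nz: "A j (\<sigma> j) \<noteq> 0"
    and opt: "(\<Sum>j\<in>UNIV. val (A j (\<sigma> j))) = val (sdet A)"
begin

lemma permutes_pow: "(\<sigma> ^^ s) permutes UNIV"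
  using perm by (rule permutes_funpow)

text \<open>For \<open>n\<close> with \<open>\<sigma> ^^ n = id\<close> this is \<open>n\<close>
  times the mean weight of the cycle of \<open>j\<close>, obtained without division.\<close>

definition cycle_weight :: "nat \<Rightarrow> 'n \<Rightarrow> 'a" where
  "cycle_weight n j = (\<Sum>s<n. val (A ((\<sigma> ^^ s) j) ((\<sigma> ^^ Suc s) j)))"

lemma sum_cycle_weight: "(\<Sum>j\<in>UNIV. cycle_weight n j) = nmul n (val (sdet A))"
proof -
  have "(\<Sum>j\<in>UNIV. cycle_weight n j) = (\<Sum>s<n. \<Sum>j\<in>UNIV. val (A ((\<sigma> ^^ s) j) (\<sigma> ((\<sigma> ^^ s) j))))"
    unfolding cycle_weight_def by (subst sum.swap) simp
  also have "\<dots> = (\<Sum>s<n. \<Sum>j\<in>UNIV. val (A j (\<sigma> j)))"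
    by (rule sum.cong[OF refl])
      (use sum.permute[OF permutes_pow, of "\<lambda>j. val (A j (\<sigma> j))"] in \<open>simp add: comp_def\<close>)
  finally show ?thesis by (simp add: opt nmul_def)
qed

text \<open>Each diagonal entry is at least the weight of the walk along \<sigma>. These weights add
  up to m times the value of det A, which bounds det(A^m) and hence the sum of the diagonal entries
  from above. So all inequalities are equalities, and the identity is the optimal permutation of
  A^m.\<close>

lemma smat_pow_diag:
  assumes "\<sigma> ^^ m = id"
  shows "tangible (smat_pow A m j j)"
    "val (smat_pow A m j j) = (\<Sum>s<m. val (A ((\<sigma> ^^ s) j) ((\<sigma> ^^ Suc s) j)))"
proof -
  let ?w = "\<lambda>j. \<Sum>s<m. val (A ((\<sigma> ^^ s) j) ((\<sigma> ^^ Suc s) j))"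
  have ge: "smat_pow A m j j \<noteq> 0 \<and> ?w j \<le> val (smat_pow A m j j)" for j
    using smat_pow_walk_ge[of m A "\<lambda>s. (\<sigma> ^^ s) j"] nz assms by simp
  have t: "tangible (sdet (smat_pow A m))"
    using sn by (simp add: strongly_nonsingular_def nonsingular_def)
  have tot: "(\<Sum>j\<in>UNIV. ?w j) = nmul m (val (sdet A))"
    using sum_cycle_weight[of m] by (simp add: cycle_weight_def)
  have id: "id permutes (UNIV::'n set)" by (rule permutes_id)
  have "(\<Sum>j\<in>UNIV. val (smat_pow A m j (id j))) \<le> val (sdet (smat_pow A m))"
    by (rule sdet_term_ge(2)[OF id]) (simp add: ge)
  then have up: "(\<Sum>j\<in>UNIV. val (smat_pow A m j j)) \<le> nmul m (val (sdet A))"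
    using strongly_nonsingular_sdet_pow_le[OF sn, of m] by simp
  have lo: "(\<Sum>j\<in>UNIV. ?w j) \<le> (\<Sum>j\<in>UNIV. val (smat_pow A m j j))"
    using ge by (intro sum_mono) auto
  have eq: "(\<Sum>j\<in>UNIV. ?w j) = (\<Sum>j\<in>UNIV. val (smat_pow A m j j))"
    using up lo tot by (intro antisym) auto
  show "val (smat_pow A m j j) = ?w j"
    using sum_mono_inv[OF eq, of j] ge by simp
  have "(\<Sum>j\<in>UNIV. val (smat_pow A m j (id j))) = val (sdet (smat_pow A m))"
    using up lo tot strongly_nonsingular_sdet_pow_le[OF sn, of m]
      \<open>(\<Sum>j\<in>UNIV. val (smat_pow A m j (id j))) \<le> val (sdet (smat_pow A m))\<close> by auto
  from tangible_sdet_term(1)[OF t id _ this, of j] ge show "tangible (smat_pow A m j j)" by simp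
qed

lemma closed_walk_le:
  assumes "\<sigma> ^^ m = id" "\<gamma> m = \<gamma> 0" "\<And>s. s < m \<Longrightarrow> A (\<gamma> s) (\<gamma> (Suc s)) \<noteq> 0"
  shows "(\<Sum>s<m. val (A (\<gamma> s) (\<gamma> (Suc s)))) \<le> (\<Sum>s<m. val (A ((\<sigma> ^^ s) (\<gamma> 0)) ((\<sigma> ^^ Suc s) (\<gamma> 0))))"
  using smat_pow_walk_ge[of m A \<gamma>] smat_pow_diag(2)[OF assms(1), of "\<gamma> 0"] assms by simp

text \<open>Sorting the walks behind the diagonal entry by their last step gives a tangible sum,
  attained at the \<sigma>-predecessor of \<open>\<gamma> 0\<close>. A walk arriving from elsewhere
  belongs to another summand and is strictly lighter.\<close>

lemma closed_walk_less:
  assumes "\<sigma> ^^ Suc m = id" "\<gamma> (Suc m) = \<gamma> 0" "\<And>s. s < Suc m \<Longrightarrow> A (\<gamma> s) (\<gamma> (Suc s)) \<noteq> 0"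
    and "\<sigma> (\<gamma> m) \<noteq> \<gamma> 0"
  shows "(\<Sum>s<Suc m. val (A (\<gamma> s) (\<gamma> (Suc s)))) < (\<Sum>s<Suc m. val (A ((\<sigma> ^^ s) (\<gamma> 0)) ((\<sigma> ^^ Suc s) (\<gamma> 0))))"
proof -
  let ?f = "\<lambda>k. smat_pow A m (\<gamma> 0) k * A k (\<gamma> 0)"
  let ?k = "(\<sigma> ^^ m) (\<gamma> 0)"
  have sum: "smat_pow A (Suc m) (\<gamma> 0) (\<gamma> 0) = sum ?f UNIV" by (simp add: smat_mult_def)
  have k: "\<sigma> ?k = \<gamma> 0" using fun_cong[OF assms(1), of "\<gamma> 0"] by simp
  have W: "smat_pow A m (\<gamma> 0) (\<gamma> m) \<noteq> 0" "(\<Sum>s<m. val (A (\<gamma> s) (\<gamma> (Suc s)))) \<le> val (smat_pow A m (\<gamma> 0) (\<gamma> m))"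
    using smat_pow_walk_ge[of m A \<gamma>] assms(3) by auto
  have V: "smat_pow A m (\<gamma> 0) ?k \<noteq> 0"
    "(\<Sum>s<m. val (A ((\<sigma> ^^ s) (\<gamma> 0)) ((\<sigma> ^^ Suc s) (\<gamma> 0)))) \<le> val (smat_pow A m (\<gamma> 0) ?k)"
    using smat_pow_walk_ge[of m A "\<lambda>s. (\<sigma> ^^ s) (\<gamma> 0)"] nz by auto
  have e: "A ?k (\<gamma> 0) \<noteq> 0" "A (\<gamma> m) (\<gamma> 0) \<noteq> 0" using nz[of ?k] k assms(2) assms(3)[of m] by auto
  have fk: "?f ?k \<noteq> 0" and fm: "?f (\<gamma> m) \<noteq> 0" using W V e by simp_all
  have t: "tangible (sum ?f UNIV)" and v: "val (sum ?f UNIV) =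
      (\<Sum>s<Suc m. val (A ((\<sigma> ^^ s) (\<gamma> 0)) ((\<sigma> ^^ Suc s) (\<gamma> 0))))"
    using smat_pow_diag[OF assms(1), of "\<gamma> 0"] unfolding sum by auto
  have "val (sum ?f UNIV) \<le> val (?f ?k)"
    unfolding v using V e k by (simp add: val_mult add_right_mono)
  then have "val (?f ?k) = val (sum ?f UNIV)"
    using val_sum_ge(2)[of UNIV ?k ?f] fk by simp
  moreover have "\<gamma> m \<noteq> ?k" using k assms(4) by metis
  ultimately have "val (?f (\<gamma> m)) < val (?f ?k)"
    using tangible_sum_term(2)[OF _ t _ fk, of "\<gamma> m"] fm by auto
  also have "\<dots> = val (sum ?f UNIV)" using \<open>val (?f ?k) = val (sum ?f UNIV)\<close> .
  finally have "val (?f (\<gamma> m)) < val (sum ?f UNIV)" .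
  moreover have "(\<Sum>s<Suc m. val (A (\<gamma> s) (\<gamma> (Suc s)))) \<le> val (?f (\<gamma> m))"
    using W e assms(2) by (simp add: val_mult add_right_mono)
  ultimately show ?thesis unfolding v by simp
qed

text \<open>The walk \<open>\<gamma>\<close> is traversed \<open>n\<close> times, so that its length becomes a multiple of the
order of \<open>\<sigma>\<close> and it can be compared with a diagonal entry of a power of \<open>A\<close>.\<close>

lemma periodic_walk_le:
  assumes n: "\<sigma> ^^ n = id" "0 < n" and L: "0 < L"
    and per: "\<And>s. \<gamma> (s + L) = \<gamma> s"
    and E: "\<And>s. A (\<gamma> s) (\<gamma> (Suc s)) \<noteq> 0"
  shows "nmul n (\<Sum>s<L. val (A (\<gamma> s) (\<gamma> (Suc s)))) \<le> nmul L (cycle_weight n (\<gamma> (Suc q)))"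
    "\<sigma> (\<gamma> q) \<noteq> \<gamma> (Suc q) \<Longrightarrow>
      nmul n (\<Sum>s<L. val (A (\<gamma> s) (\<gamma> (Suc s)))) < nmul L (cycle_weight n (\<gamma> (Suc q)))"
proof -
  let ?h = "\<lambda>s. val (A (\<gamma> s) (\<gamma> (Suc s)))"
  \<comment> \<open>Starting after the edge from \<open>\<gamma> q\<close> makes that edge the last
    one, where \<open>closed_walk_less\<close> detects a deviation from \<sigma>.\<close>
  let ?g = "\<lambda>s. \<gamma> (s + Suc q)"
  have hper: "?h (s + L) = ?h s" for s using per[of s] per[of "Suc s"] by simp
  have "(\<Sum>s<n * L. val (A (?g s) (?g (Suc s)))) = nmul n (\<Sum>s<L. ?h (s + Suc q))"
    using sum_periodic[of "\<lambda>s. ?h (s + Suc q)" L n] hper[of "_ + Suc q"] by (simp add: ac_simps)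
  then have lhs: "(\<Sum>s<n * L. val (A (?g s) (?g (Suc s)))) = nmul n (\<Sum>s<L. ?h s)"
    using sum_periodic_shift[of ?h L "Suc q"] hper by simp
  have sper: "(\<sigma> ^^ (s + n)) = \<sigma> ^^ s" for s by (simp add: funpow_add n)
  have rhs: "(\<Sum>s<n * L. val (A ((\<sigma> ^^ s) j) ((\<sigma> ^^ Suc s) j))) = nmul L (cycle_weight n j)" for j
    using sum_periodic[of "\<lambda>s. val (A ((\<sigma> ^^ s) j) ((\<sigma> ^^ Suc s) j))" n L] sper
    by (simp add: cycle_weight_def mult.commute)
  have idm: "\<sigma> ^^ (n * L) = id" by (metis funpow_mult id_funpow n(1))
  have gm: "?g (n * L) = ?g 0"
    using periodic_add_mult[of \<gamma> L "Suc q" n] per by (simp add: add.commute)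
  show "nmul n (\<Sum>s<L. ?h s) \<le> nmul L (cycle_weight n (\<gamma> (Suc q)))"
    using closed_walk_le[of "n * L" ?g, OF idm gm] E unfolding lhs rhs by simp
  assume q: "\<sigma> (\<gamma> q) \<noteq> \<gamma> (Suc q)"
  obtain m where m: "n * L = Suc m" using n L by (metis gr0_conv_Suc mult_pos_pos)
  have "m + Suc q = q + n * L" using m by simp
  then have "?g m = \<gamma> q" using periodic_add_mult[of \<gamma> L q n] per by metis
  then show "nmul n (\<Sum>s<L. ?h s) < nmul L (cycle_weight n (\<gamma> (Suc q)))"
    using closed_walk_less[of m ?g] idm gm E q lhs rhs unfolding m by simp
qed

text \<open>The bounds for the different starting points are added up, so that the walk is compared
  with \<open>cycle_weight\<close> summed over its vertices. This is the form that a reduced weight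
  defined edge by edge needs.\<close>

lemma periodic_walk_total:
  assumes n: "\<sigma> ^^ n = id" "0 < n" and L: "0 < L"
    and per: "\<And>s. \<gamma> (s + L) = \<gamma> s"
    and E: "\<And>s. A (\<gamma> s) (\<gamma> (Suc s)) \<noteq> 0"
  shows "nmul n (\<Sum>s<L. val (A (\<gamma> s) (\<gamma> (Suc s)))) \<le> (\<Sum>s<L. cycle_weight n (\<gamma> s))"
    "q < L \<Longrightarrow> \<sigma> (\<gamma> q) \<noteq> \<gamma> (Suc q) \<Longrightarrow>
      nmul n (\<Sum>s<L. val (A (\<gamma> s) (\<gamma> (Suc s)))) < (\<Sum>s<L. cycle_weight n (\<gamma> s))"
proof -
  let ?w = "nmul n (\<Sum>s<L. val (A (\<gamma> s) (\<gamma> (Suc s))))"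
  have l: "(\<Sum>q<L. ?w) = nmul L ?w" by (simp add: nmul_def)
  have r: "(\<Sum>q<L. nmul L (cycle_weight n (\<gamma> (Suc q)))) = nmul L (\<Sum>s<L. cycle_weight n (\<gamma> s))"
    using sum_periodic_shift[of "\<lambda>s. cycle_weight n (\<gamma> s)" L 1] per by (simp add: nmul_sum[symmetric])
  note le = periodic_walk_le[OF n L per E]
  have "nmul L ?w \<le> nmul L (\<Sum>s<L. cycle_weight n (\<gamma> s))"
    unfolding l[symmetric] r[symmetric] by (intro sum_mono le)
  then show "?w \<le> (\<Sum>s<L. cycle_weight n (\<gamma> s))" using L by (simp add: nmul_le_iff)
  assume q: "q < L" "\<sigma> (\<gamma> q) \<noteq> \<gamma> (Suc q)"
  have "nmul L ?w < nmul L (\<Sum>s<L. cycle_weight n (\<gamma> s))"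
    unfolding l[symmetric] r[symmetric]
    by (rule sum_strict_mono_ex1) (use le q in auto)
  then show "?w < (\<Sum>s<L. cycle_weight n (\<gamma> s))" using L by (simp add: nmul_less_iff)
qed

end

section \<open>Scaling the matrix so that the optimal permutation dominates each row\<close>

text \<open>\<open>M j\<close> is \<open>N\<close> times the mean weight of the \<open>\<sigma>\<close>-cycle through \<open>j\<close>; the multiple \<open>N\<close> stands in
for division, which the value group need not admit.\<close>

locale dominant_permutation =
  fixes A :: "('a::linordered_ab_group_add, 'n::finite) smat" and \<sigma> :: "'n \<Rightarrow> 'n"
    and N :: nat and M y :: "'n \<Rightarrow> 'a"
  assumes perm: "\<sigma> permutes UNIV"
    and N_pos: "0 < N"
    and tan: "tangible (A j (\<sigma> j))"
    and M_perm: "M (\<sigma> j) = M j"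
    and tight: "nmul N (val (A j (\<sigma> j))) + y (\<sigma> j) = M j + y j"
    and slack: "A j k \<noteq> 0 \<Longrightarrow> k \<noteq> \<sigma> j \<Longrightarrow> nmul N (val (A j k)) + y k < M j + y j"

text \<open>The reduced weight \<open>c\<close> of an edge subtracts the cycle weight at its tail,
  so cycles become nonpositive, and negative if they leave \<sigma>. A potential for a slight
  perturbation yields \<open>slack\<close>. The positive \<open>e\<close> provides a perturbation
  even if no cycle leaves \<sigma>.\<close>

lemma exists_dominant_permutation:
  fixes A :: "('a::linordered_ab_group_add, 'n::finite) smat" and e :: 'a
  assumes sn: "strongly_nonsingular A" and e: "0 < e"
  shows "\<exists>\<sigma> N M y. dominant_permutation A \<sigma> N M y"
proof -
  note t = strongly_nonsingular_sdet[OF sn]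
  obtain \<sigma> where \<sigma>: "\<sigma> permutes UNIV" "\<And>j. A j (\<sigma> j) \<noteq> 0" "(\<Sum>j\<in>UNIV. val (A j (\<sigma> j))) = val (sdet A)"
    using sdet_attained[OF tangible_nonzero[OF t]] by blast
  interpret optimal_permutation A \<sigma> by unfold_locales (use sn \<sigma> in auto)
  have "permutation \<sigma>" using \<sigma>(1) permutation_permutes by (metis finite_UNIV)
  then obtain n where n: "\<sigma> ^^ n = id" "0 < n" by (rule permutation_is_nilpotent)
  define m where "m = card (UNIV :: 'n set)"
  have m: "0 < m" by (simp add: m_def card_gt_0_iff)
  define c where "c j k = nmul n (val (A j k)) - cycle_weight n j" for j k
  define C where "C xs = (\<Sum>s<length xs. c (xs ! s) (xs ! (Suc s mod length xs)))" for xs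
  define cyc where "cyc xs \<longleftrightarrow> xs \<noteq> [] \<and> distinct xs \<and>
    (\<forall>s<length xs. A (xs ! s) (xs ! (Suc s mod length xs)) \<noteq> 0)" for xs
  define bad where "bad xs \<longleftrightarrow> (\<exists>s<length xs. \<sigma> (xs ! s) \<noteq> xs ! (Suc s mod length xs))" for xs
  have C: "C xs \<le> 0 \<and> (bad xs \<longrightarrow> C xs < 0)" if "cyc xs" for xs
  proof -
    let ?L = "length xs" and ?g = "\<lambda>s. xs ! (s mod length xs)"
    have L: "0 < ?L" using that by (simp add: cyc_def)
    have E: "A (?g s) (?g (Suc s)) \<noteq> 0" for s
    proof -
      have "s mod ?L < ?L" using L by simp
      moreover have "Suc (s mod ?L) mod ?L = Suc s mod ?L" by (simp add: mod_Suc_eq)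
      ultimately show ?thesis using that unfolding cyc_def by metis
    qed
    note * = periodic_walk_total[of n ?L ?g, OF n L _ E]
    have eq: "C xs = nmul n (\<Sum>s<?L. val (A (?g s) (?g (Suc s)))) - (\<Sum>s<?L. cycle_weight n (?g s))"
      by (simp add: C_def c_def sum_subtractf nmul_sum)
    have "C xs < 0" if "bad xs"
    proof -
      from that obtain q where "q < ?L" "\<sigma> (?g q) \<noteq> ?g (Suc q)" by (auto simp: bad_def)
      from *(2)[OF _ this] show ?thesis unfolding eq by simp
    qed
    moreover have "C xs \<le> 0" unfolding eq using *(1) by simp
    ultimately show ?thesis by blast
  qed
  \<comment> \<open>Perturbing the edges outside \<open>\<sigma>\<close> by \<open>\<epsilon>\<close> makes the potential inequalities strict on them.\<close>
  define D where "D = insert e ((\<lambda>xs. - C xs) ` {xs. cyc xs \<and> bad xs})"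
  define \<epsilon> where "\<epsilon> = Min D"
  have "finite {xs::'n list. distinct xs}"
    using finite_subset_distinct[of "UNIV::'n set"] by simp
  then have "finite {xs. cyc xs \<and> bad xs}" by (rule finite_subset[rotated]) (auto simp: cyc_def)
  then have finD: "finite D" by (simp add: D_def)
  have \<epsilon>: "0 < \<epsilon>" unfolding \<epsilon>_def using finD e C by (subst Min_gr_iff) (auto simp: D_def)
  have \<epsilon>C: "C xs + \<epsilon> \<le> 0" if "cyc xs" "bad xs" for xs
  proof -
    have "\<epsilon> \<le> - C xs" unfolding \<epsilon>_def using finD that by (intro Min_le) (auto simp: D_def)
    then show ?thesis by (metis add.commute le_minus_iff neg_le_0_iff_le minus_add_cancel add_left_mono add.right_inverse)
  qed
  \<comment> \<open>A simple cycle has at most \<open>m\<close> edges, so after scaling by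
    \<open>m\<close> it can absorb one \<epsilon> per edge.\<close>
  define c' where "c' j k = nmul m (c j k) + (if k = \<sigma> j then 0 else \<epsilon>)" for j k
  have "\<exists>y. \<forall>j k. A j k \<noteq> 0 \<longrightarrow> c' j k + y k \<le> y j"
  proof (rule potential_exists)
    fix xs assume xs: "xs \<noteq> []" "distinct xs"
      "\<And>s. s < length xs \<Longrightarrow> A (xs ! s) (xs ! (Suc s mod length xs)) \<noteq> 0"
    then have cy: "cyc xs" by (simp add: cyc_def)
    let ?S = "\<Sum>s<length xs. (if xs ! (Suc s mod length xs) = \<sigma> (xs ! s) then 0 else \<epsilon>)"
    have eq: "(\<Sum>s<length xs. c' (xs ! s) (xs ! (Suc s mod length xs))) = nmul m (C xs) + ?S"
      by (simp add: c'_def sum.distrib C_def nmul_sum)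
    show "(\<Sum>s<length xs. c' (xs ! s) (xs ! (Suc s mod length xs))) \<le> 0"
    proof (cases "bad xs")
      case False
      then have "?S = 0" by (intro sum.neutral) (auto simp: bad_def)
      then show ?thesis unfolding eq using nmul_mono[of "C xs" 0 m] C[OF cy] by simp
    next
      case True
      have "?S \<le> (\<Sum>s<length xs. \<epsilon>)" using \<epsilon> by (intro sum_mono) auto
      also have "\<dots> = nmul (length xs) \<epsilon>" by (simp add: nmul_def)
      also have "\<dots> \<le> nmul m \<epsilon>"
      proof (rule nmul_left_mono)
        show "length xs \<le> m" unfolding m_def using xs(2)
          by (metis distinct_card card_mono finite_UNIV subset_UNIV)
      qed (use \<epsilon> in simp)
      finally have "nmul m (C xs) + ?S \<le> nmul m (C xs + \<epsilon>)" by (simp add: nmul_add)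
      also have "\<dots> \<le> 0" using nmul_mono[OF \<epsilon>C[OF cy True], of m] by simp
      finally show ?thesis unfolding eq .
    qed
  qed
  then obtain y where y: "\<And>j k. A j k \<noteq> 0 \<Longrightarrow> c' j k + y k \<le> y j" by blast
  define M where "M j = nmul m (cycle_weight n j)" for j
  have le: "nmul (m * n) (val (A j k)) + (if k = \<sigma> j then 0 else \<epsilon>) + y k \<le> M j + y j"
    if "A j k \<noteq> 0" for j k
  proof -
    have "nmul (m * n) (val (A j k)) + (if k = \<sigma> j then 0 else \<epsilon>) + y k = M j + (c' j k + y k)"
      by (simp add: c'_def c_def nmul_diff nmul_mult M_def algebra_simps)
    also have "\<dots> \<le> M j + y j" using y[OF that] by (rule add_left_mono)
    finally show ?thesis .
  qed
  have shift: "(\<Sum>s<n. val (A ((\<sigma> ^^ s) (\<sigma> j)) ((\<sigma> ^^ Suc s) (\<sigma> j)))) =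
      (\<Sum>s<n. val (A ((\<sigma> ^^ s) j) ((\<sigma> ^^ Suc s) j)))" for j
    using sum_periodic_shift[of "\<lambda>s. val (A ((\<sigma> ^^ s) j) ((\<sigma> ^^ Suc s) j))" n 1] n
    by (simp add: funpow_add funpow_swap1)
  \<comment> \<open>The inequalities \<open>le\<close> on the edges of \<sigma> have equal totals on
    both sides, so each of them is an equality; this gives \<open>tight\<close>.\<close>
  have tot: "(\<Sum>j\<in>UNIV. nmul (m * n) (val (A j (\<sigma> j))) + y (\<sigma> j)) = (\<Sum>j\<in>UNIV. M j + y j)"
  proof -
    have "(\<Sum>j\<in>UNIV. y (\<sigma> j)) = (\<Sum>j\<in>UNIV. y j)"
      using sum.permute[OF \<sigma>(1), of y] by (simp add: comp_def)
    moreover have "(\<Sum>j\<in>UNIV. M j) = nmul (m * n) (val (sdet A))"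
      by (simp add: M_def nmul_sum[symmetric] sum_cycle_weight nmul_mult)
    ultimately show ?thesis by (simp add: sum.distrib nmul_sum[symmetric] opt)
  qed
  have "dominant_permutation A \<sigma> (m * n) M y"
  proof
    show "\<sigma> permutes UNIV" by fact
    show "0 < m * n" using m n by simp
    show "tangible (A j (\<sigma> j))" for j by (rule tangible_sdet_term(1)[OF t \<sigma>])
    show "M (\<sigma> j) = M j" for j using shift by (simp add: M_def cycle_weight_def del: funpow.simps)
    show "nmul (m * n) (val (A j (\<sigma> j))) + y (\<sigma> j) = M j + y j" for j
      by (rule sum_mono_inv[OF tot]) (use le[OF \<sigma>(2)] in auto)
    show "nmul (m * n) (val (A j k)) + y k < M j + y j" if "A j k \<noteq> 0" "k \<noteq> \<sigma> j" for j k
    proof -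
      have "nmul (m * n) (val (A j k)) + y k < nmul (m * n) (val (A j k)) + \<epsilon> + y k"
        using \<epsilon> by simp
      also have "\<dots> \<le> M j + y j" using le[OF that(1)] that(2) by simp
      finally show ?thesis .
    qed
  qed
  then show ?thesis by blast
qed

section \<open>The characteristic polynomial\<close>

lemma sum_permute_potential:
  fixes y :: "'n::finite \<Rightarrow> 'a::linordered_ab_group_add"
  assumes "p permutes UNIV"
  shows "(\<Sum>j\<in>UNIV. nmul N (f j) + y (p j)) = nmul N (\<Sum>j\<in>UNIV. f j) + (\<Sum>j\<in>UNIV. y j)"
  using sum.permute[OF assms, of y] by (simp add: sum.distrib nmul_sum comp_def)

lemma permutesI_inj:
  fixes p :: "'n::finite \<Rightarrow> 'n"
  assumes "inj p"
  shows "p permutes UNIV"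
  by (metis assms finite_UNIV inj_imp_permutes UNIV_I)

context dominant_permutation
begin

lemma entry_le: "A j k \<noteq> 0 \<Longrightarrow> nmul N (val (A j k)) + y k \<le> M j + y j"
  using slack[of j k] tight[of j] by (cases "k = \<sigma> j") auto

text \<open>After the scaling by \<open>y\<close>, row \<open>j\<close> of xI + A is bounded by
  \<open>max (nmul N a) (M j)\<close>, and the permutation \<open>r\<close> attains this bound in
  every row. If no \<open>M j\<close> equals \<open>nmul N a\<close>, each row attains it only at
  \<open>r j\<close> and by a tangible entry, so no other permutation ties.\<close>

lemma charpoly_Tan:
  shows "charpoly_fun A (Tan a) \<noteq> 0"
    and "nmul N (val (charpoly_fun A (Tan a))) = (\<Sum>j\<in>UNIV. max (nmul N a) (M j))"
    and "(\<And>j. M j \<noteq> nmul N a) \<Longrightarrow> tangible (charpoly_fun A (Tan a))"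
proof -
  define X where "X = smat_add (smat_scal (Tan a)) A"
  have cf: "charpoly_fun A (Tan a) = sdet X" by (simp add: charpoly_fun_def X_def)
  have Xd: "X j j = Tan a + A j j" and Xo: "k \<noteq> j \<Longrightarrow> X j k = A j k" for j k
    by (auto simp: X_def smat_add_def smat_scal_def)
  have dle: "nmul N (val (A j j)) \<le> M j" if "A j j \<noteq> 0" for j
    using entry_le[OF that] by simp
  have Xle: "nmul N (val (X j k)) + y k \<le> max (nmul N a) (M j) + y j" if "X j k \<noteq> 0" for j k
  proof (cases "k = j")
    case True
    have "nmul N (val (X j j)) \<le> max (nmul N a) (M j)"
      using dle[of j] by (cases "A j j = 0") (auto simp: Xd val_add nmul_max max.coboundedI2)
    with True show ?thesis by simp
  next
    case False
    then have "nmul N (val (X j k)) + y k \<le> M j + y j" using that entry_le[of j k] by (simp add: Xo)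
    also have "\<dots> \<le> max (nmul N a) (M j) + y j" by simp
    finally show ?thesis .
  qed
  \<comment> \<open>Cycles of mean at least \<open>a\<close> are followed, all other vertices are
    fixed. Since \<open>M\<close> is constant along \<sigma>, \<open>r\<close> is injective.\<close>
  define r where "r j = (if nmul N a \<le> M j then \<sigma> j else j)" for j
  have "inj r"
  proof (rule injI)
    fix i j assume "r i = r j"
    then show "i = j"
      using M_perm[of i] M_perm[of j] permutes_inj[OF perm]
      by (auto simp: r_def inj_eq split: if_splits)
  qed
  then have r: "r permutes UNIV" by (rule permutesI_inj)
  have Xr: "X j (r j) \<noteq> 0 \<and> nmul N (val (X j (r j))) + y (r j) = max (nmul N a) (M j) + y j" for j
  proof (cases "nmul N a \<le> M j")
    case True
    have nz: "A j (\<sigma> j) \<noteq> 0" using tan tangible_nonzero by blast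
    have X: "X j (\<sigma> j) \<noteq> 0 \<and> val (A j (\<sigma> j)) \<le> val (X j (\<sigma> j))"
      using nz val_add_ge[OF nz, of "Tan a"] by (cases "\<sigma> j = j") (auto simp: Xo Xd add.commute)
    then have "M j + y j \<le> nmul N (val (X j (\<sigma> j))) + y (\<sigma> j)"
      using tight[of j] nmul_mono[of "val (A j (\<sigma> j))" "val (X j (\<sigma> j))" N] by (metis add_right_mono)
    then show ?thesis using True X Xle[of j "\<sigma> j"] by (simp add: r_def max_absorb2)
  next
    case False
    have "X j j \<noteq> 0 \<and> a \<le> val (X j j)" using val_add_ge[of "Tan a" "A j j"] by (simp add: Xd)
    then show ?thesis using False Xle[of j j] nmul_mono[of a "val (X j j)" N]
      by (simp add: r_def max_absorb1)
  qed
  have rv: "nmul N (\<Sum>j\<in>UNIV. val (X j (r j))) = (\<Sum>j\<in>UNIV. max (nmul N a) (M j))"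
    using sum_permute_potential[OF r, of N "\<lambda>j. val (X j (r j))" y] Xr by (simp add: sum.distrib)
  have up: "nmul N (\<Sum>j\<in>UNIV. val (X j (p j))) \<le> (\<Sum>j\<in>UNIV. max (nmul N a) (M j))"
    if "p permutes UNIV" "\<And>j. X j (p j) \<noteq> 0" for p
    using sum_permute_potential[OF that(1), of N "\<lambda>j. val (X j (p j))" y]
      sum_mono[of UNIV "\<lambda>j. nmul N (val (X j (p j))) + y (p j)" "\<lambda>j. max (nmul N a) (M j) + y j"]
      Xle that(2) by (simp add: sum.distrib)
  note ge = sdet_term_ge[of r X, OF r]
  show nz: "charpoly_fun A (Tan a) \<noteq> 0" using ge(1) Xr by (simp add: cf)
  then obtain p where p: "p permutes UNIV" "\<And>i. X i (p i) \<noteq> 0" "(\<Sum>i\<in>UNIV. val (X i (p i))) = val (sdet X)"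
    using sdet_attained[of X] by (auto simp: cf)
  have "(\<Sum>i\<in>UNIV. val (X i (r i))) \<le> val (sdet X)" using ge(2) Xr by simp
  then show "nmul N (val (charpoly_fun A (Tan a))) = (\<Sum>j\<in>UNIV. max (nmul N a) (M j))"
    using up[OF p(1,2)] p(3) rv nmul_mono[of "\<Sum>i\<in>UNIV. val (X i (r i))" "val (sdet X)" N]
    by (simp add: cf)
  assume ne: "\<And>j. M j \<noteq> nmul N a"
  have strict: "nmul N (val (X j k)) + y k < max (nmul N a) (M j) + y j" if "X j k \<noteq> 0" "k \<noteq> r j" for j k
  proof (cases "nmul N a < M j")
    case True
    then have k: "k \<noteq> \<sigma> j" using that by (simp add: r_def less_imp_le)
    show ?thesis
    proof (cases "k = j")
      case False
      then show ?thesis using that k slack[of j k] True by (simp add: Xo max_absorb2)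
    next
      case kj: True
      have "nmul N (val (X j j)) < M j"
        using True slack[of j j] k kj by (cases "A j j = 0") (auto simp: Xd val_add nmul_max)
      then show ?thesis using kj True by (simp add: max_absorb2)
    qed
  next
    case False
    then have lt: "M j < nmul N a" using ne[of j] by simp
    have k: "k \<noteq> j" using that False by (auto simp: r_def less_le ne[of j, symmetric])
    then have "nmul N (val (X j k)) + y k \<le> M j + y j" using that entry_le by (simp add: Xo)
    also have "\<dots> < max (nmul N a) (M j) + y j" using lt by simp
    finally show ?thesis .
  qed
  have tanX: "tangible (X j (r j))" for j
  proof (cases "nmul N a < M j")
    case True
    show ?thesis
    proof (cases "\<sigma> j = j")
      case False
      then show ?thesis using True tan[of j] by (simp add: r_def Xo less_imp_le)
    next
      case s: True
      then have "nmul N a < nmul N (val (A j j))" using True tight[of j] by simp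
      then have "a < val (A j j)" using N_pos by (simp add: nmul_less_iff)
      then show ?thesis using True s tan[of j] by (simp add: r_def Xd tangible_add tangible_nonzero less_imp_le)
    qed
  next
    case False
    then have lt: "M j < nmul N a" using ne[of j] by simp
    have "val (A j j) < a" if "A j j \<noteq> 0"
      using le_less_trans[OF dle[OF that] lt] N_pos by (simp add: nmul_less_iff)
    then show ?thesis using lt by (cases "A j j = 0") (auto simp: r_def Xd tangible_add)
  qed
  have "val (\<Prod>j\<in>UNIV. X j (q j)) < val (\<Prod>j\<in>UNIV. X j (r j))"
    if q: "q permutes UNIV" "q \<noteq> r" "\<And>j. X j (q j) \<noteq> 0" for q
  proof -
    from q(2) obtain i where i: "q i \<noteq> r i" by auto
    have "(\<Sum>j\<in>UNIV. nmul N (val (X j (q j))) + y (q j)) < (\<Sum>j\<in>UNIV. max (nmul N a) (M j) + y j)"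
      by (rule sum_strict_mono_ex1) (use Xle strict[of i "q i"] i q(3) in auto)
    then have "nmul N (\<Sum>j\<in>UNIV. val (X j (q j))) < nmul N (\<Sum>j\<in>UNIV. val (X j (r j)))"
      using sum_permute_potential[OF q(1), of N "\<lambda>j. val (X j (q j))" y] rv by (simp add: sum.distrib)
    then show ?thesis using N_pos q(3) Xr by (simp add: nmul_less_iff val_prod)
  qed
  then show "tangible (charpoly_fun A (Tan a))"
    unfolding cf sdet_def
    by (intro tangible_sumI[of _ r]) (auto simp: r tanX tangible_prod st_prod_eq_0 finite_permutations)
qed

end

text \<open>\<open>\<delta>\<close> is the second difference with step \<open>d\<close> of max(_, m)
  at \<open>x\<close>. It vanishes unless the bend \<open>m\<close> lies within distance
  \<open>d\<close> of \<open>x\<close>, and serves to count bends near a root in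
  \<open>multiplicity\<close>.\<close>

lemma max_second_difference:
  fixes x d m :: "'a::linordered_ab_group_add"
  assumes "0 < d"
  defines "\<delta> \<equiv> max (x + d) m - max x m - (max x m - max (x - d) m)"
  shows "0 \<le> \<delta>" "m \<le> x \<Longrightarrow> x < m + d \<Longrightarrow> 0 < \<delta>" "m = x \<Longrightarrow> \<delta> = d"
    "m + d \<le> x \<Longrightarrow> \<delta> = 0" "x + d \<le> m \<Longrightarrow> \<delta> = 0"
proof -
  have d: "x < x + d" "x - d < x" using assms(1) by simp_all
  consider "m \<le> x - d" | "x - d < m" "m \<le> x" | "x < m" "m \<le> x + d" | "x + d < m" by force
  then show "0 \<le> \<delta>"
  proof cases
    case 1
    then have "m \<le> x" "m \<le> x + d" using d by (meson less_imp_le order_trans)+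
    with 1 show ?thesis by (simp add: \<delta>_def max_absorb1)
  next
    case 2
    then have "m \<le> x + d" using d by (meson less_imp_le order_trans)
    with 2 have "\<delta> = m - (x - d)" by (simp add: \<delta>_def max_absorb1 max_absorb2)
    with 2 show ?thesis by simp
  next
    case 3
    then have "x - d \<le> m" using d by (meson less_imp_le order_trans)
    with 3 show ?thesis by (simp add: \<delta>_def max_absorb1 max_absorb2)
  next
    case 4
    then have "x - d \<le> m" "x \<le> m" using d by (meson less_imp_le order_trans)+
    with 4 show ?thesis by (simp add: \<delta>_def max_absorb2)
  qed
  show "0 < \<delta>" if "m \<le> x" "x < m + d"
  proof -
    have 1: "x - d < m" using that(2) by (simp add: diff_less_eq)
    have "m \<le> x + d" using that(1) d by (meson less_imp_le order_trans)
    with that 1 have "\<delta> = m - (x - d)" by (simp add: \<delta>_def max_absorb1 max_absorb2)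
    with 1 show ?thesis by simp
  qed
  show "\<delta> = d" if "m = x" using that d by (simp add: \<delta>_def max_absorb1 max_absorb2)
  show "\<delta> = 0" if "m + d \<le> x"
  proof -
    have "m \<le> x - d" using that by (simp add: le_diff_eq)
    moreover from this have "m \<le> x" "m \<le> x + d" using d by (meson less_imp_le order_trans)+
    ultimately show ?thesis by (simp add: \<delta>_def max_absorb1)
  qed
  show "\<delta> = 0" if "x + d \<le> m"
  proof -
    have "x - d \<le> m" "x \<le> m" using that d by (meson less_imp_le order_trans)+
    with that show ?thesis by (simp add: \<delta>_def max_absorb2)
  qed
qed

section \<open>Matching the roots with the cycle means\<close>

lemma nmul_le_cancel_left: "nmul m x \<le> nmul n x \<Longrightarrow> 0 < x \<Longrightarrow> m \<le> n"
  for x :: "'a::linordered_ab_group_add"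
  using nmul_left_strict_mono[of n m x] by force

lemma nmul_less_cancel_left: "nmul m x < nmul n x \<Longrightarrow> 0 < x \<Longrightarrow> m < n"
  for x :: "'a::linordered_ab_group_add"
  using nmul_left_mono[of n m x] by force

text \<open>\<open>val_eq\<close> equates, up to the factor \<open>N\<close>, the values of the
  factored characteristic polynomial and of the formula in \<open>charpoly_Tan\<close>.
  \<open>root\<close> reflects that the polynomial is tangible at points that meet no
  \<open>M j\<close>. \<open>e\<^sub>0\<close> records that the group is nontrivial.\<close>

locale root_factorization = dominant_permutation A \<sigma> N M y
  for A :: "('a::linordered_ab_group_add, 'n::finite) smat" and \<sigma> N M y +
  fixes u :: nat and l :: "nat \<Rightarrow> 'a" and t :: "nat \<Rightarrow> nat" and e\<^sub>0 :: 'a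
  assumes e0: "0 < e\<^sub>0"
    and t_pos: "k < u \<Longrightarrow> 0 < t k"
    and l_inj: "inj_on l {..<u}"
    and val_eq: "(\<Sum>k<u. nmul (N * t k) (max a (l k))) = (\<Sum>j\<in>UNIV. max (nmul N a) (M j))"
    and root: "k < u \<Longrightarrow> \<exists>j. M j = nmul N (l k)"
begin

text \<open>Both sides of \<open>val_eq\<close> are convex and piecewise linear with integral slopes. The left one is
linear between consecutive roots, the right one bends at each \<open>M j\<close>.\<close>

lemma root_between:
  assumes zb: "z < c" "c < b" and j: "nmul N z < M j" "M j \<le> nmul N c"
  shows "\<exists>k<u. z < l k \<and> l k < b"
proof (rule ccontr)
  assume "\<not> ?thesis"
  then have no: "l k \<le> z \<or> b \<le> l k" if "k < u" for k using that by force
  \<comment> \<open>With no root inside, the left side has constant slope \<open>s\<close> from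
    \<open>z\<close> to \<open>b\<close>. The right side has average slope at least
    \<open>card J * N\<close> from \<open>c\<close> to \<open>b\<close>, but a smaller one from
    \<open>z\<close> to \<open>c\<close>, because of the bend at \<open>M j\<close>.\<close>
  define s where "s = (\<Sum>k\<in>{k\<in>{..<u}. l k \<le> z}. N * t k)"
  define J where "J = {j. M j \<le> nmul N c}"
  let ?G = "\<lambda>a. \<Sum>k<u. nmul (N * t k) (max a (l k))"
  let ?H = "\<lambda>a. \<Sum>j\<in>UNIV. max (nmul N a) (M j)"
  have G: "?G x - ?G w = nmul s (x - w)" if "z \<le> w" "w \<le> x" "x \<le> b" for w x
  proof -
    have "?G x - ?G w = (\<Sum>k<u. nmul (N * t k) (max x (l k) - max w (l k)))"
      by (simp add: sum_subtractf nmul_diff)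
    also have "\<dots> = (\<Sum>k<u. if l k \<le> z then nmul (N * t k) (x - w) else 0)"
    proof (rule sum.cong[OF refl])
      fix k assume "k \<in> {..<u}"
      then consider "l k \<le> z" | "z < l k" "b \<le> l k" using no[of k] by force
      then show "nmul (N * t k) (max x (l k) - max w (l k)) = (if l k \<le> z then nmul (N * t k) (x - w) else 0)"
        using that by cases (auto simp: max_absorb1 max_absorb2)
    qed
    also have "\<dots> = (\<Sum>k\<in>{k\<in>{..<u}. l k \<le> z}. nmul (N * t k) (x - w))"
      by (rule sum.inter_filter[symmetric]) simp
    also have "\<dots> = nmul s (x - w)" unfolding s_def by (rule sum_nmul_left) simp
    finally show ?thesis .
  qed
  have K: "(\<Sum>j\<in>UNIV. if j \<in> J then nmul N v else 0) = nmul (card J * N) v" for v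
    by (simp add: sum.inter_restrict[symmetric] sum_const_nmul nmul_mult)
  have "nmul (card J * N) (b - c) \<le> ?H b - ?H c"
    unfolding K[symmetric] sum_subtractf[symmetric]
  proof (rule sum_mono)
    fix i
    have "nmul N c \<le> nmul N b" using zb by (simp add: nmul_mono)
    then show "(if i \<in> J then nmul N (b - c) else 0) \<le> max (nmul N b) (M i) - max (nmul N c) (M i)"
      by (auto simp: J_def nmul_diff max_def)
  qed
  then have "nmul (card J * N) (b - c) \<le> nmul s (b - c)"
    using G[of c b] zb by (simp add: val_eq)
  then have 1: "card J * N \<le> s" using zb by (elim nmul_le_cancel_left) simp
  have "?H c - ?H z < nmul (card J * N) (c - z)"
    unfolding K[symmetric] sum_subtractf[symmetric]
  proof (rule sum_strict_mono_ex1)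
    have zc: "nmul N z \<le> nmul N c" using zb by (simp add: nmul_mono)
    then show "\<forall>i\<in>UNIV. max (nmul N c) (M i) - max (nmul N z) (M i) \<le> (if i \<in> J then nmul N (c - z) else 0)"
      by (auto simp: J_def nmul_diff max_def)
    show "\<exists>i\<in>UNIV. max (nmul N c) (M i) - max (nmul N z) (M i) < (if i \<in> J then nmul N (c - z) else 0)"
      using j zc by (intro bexI[of _ j]) (auto simp: J_def nmul_diff max_def)
  qed simp
  then have "nmul s (c - z) < nmul (card J * N) (c - z)"
    using G[of z c] zb by (simp add: val_eq)
  then have "s < card J * N" using zb by (elim nmul_less_cancel_left) simp
  with 1 show False by simp
qed

text \<open>If the cycle mean of \<open>j\<close> lies in the value group, the second condition makes it equal to \<open>l k\<close>.
Otherwise \<open>l k\<close> is the next element of a locally discrete value group.\<close>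

lemma exists_root_above:
  "\<exists>k<u. M j \<le> nmul N (l k) \<and> (\<forall>e>0. nmul N (l k) < M j + nmul N e)"
proof -
  \<comment> \<open>\<open>z\<close> is the largest root below the mean of \<open>j\<close>, or any
    element below it if there is no such root; so no root lies strictly between \<open>z\<close> and
    that mean.\<close>
  obtain z where z: "nmul N z < M j" "\<And>k. k < u \<Longrightarrow> nmul N (l k) < M j \<Longrightarrow> l k \<le> z"
  proof (cases "\<exists>k<u. nmul N (l k) < M j")
    case True
    let ?S = "l ` {k. k < u \<and> nmul N (l k) < M j}"
    have "finite ?S" "?S \<noteq> {}" using True by auto
    then have "Max ?S \<in> ?S" "\<And>x. x \<in> ?S \<Longrightarrow> x \<le> Max ?S" by (auto intro: Max_in)
    then show ?thesis by (intro that[of "Max ?S"]) auto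
  next
    case False
    \<comment> \<open>Being negative, \<open>z\<close> satisfies \<open>nmul N z \<le> z\<close>,
      which keeps the multiple below \<open>M j\<close>.\<close>
    define z where "z = min 0 (M j) - e\<^sub>0"
    have "z < min 0 (M j)" using e0 unfolding z_def by (simp only: diff_less_eq less_add_same_cancel1)
    then have "z < 0" "z < M j" by simp_all
    have "nmul N z \<le> nmul 1 z"
      using nmul_left_mono[of 1 N "- z"] \<open>z < 0\<close> N_pos nmul_diff[of N 0 z] by simp
    then have "nmul N z < M j" using \<open>z < M j\<close> by simp
    then show ?thesis using False by (intro that) auto
  qed
  have up: "\<exists>k<u. M j \<le> nmul N (l k)"
  proof (rule ccontr)
    assume no: "\<not> ?thesis"
    define c where "c = max 0 (M j)"
    have "nmul 1 c \<le> nmul N c" using N_pos by (intro nmul_left_mono) (auto simp: c_def)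
    then have c: "M j \<le> nmul N c" by (simp add: c_def)
    then have "z < c" using less_le_trans[OF z(1) c] N_pos by (simp add: nmul_less_iff)
    from root_between[OF this _ z(1) c, of "c + e\<^sub>0"] e0 obtain k where "k < u" "z < l k" by auto
    with no z(2)[of k] show False by force
  qed
  \<comment> \<open>The least root at or above the mean is taken. If it could be lowered by some
    positive \<open>e\<close> without falling below the mean, \<open>root_between\<close> would find
    a smaller such root.\<close>
  let ?S = "l ` {k. k < u \<and> M j \<le> nmul N (l k)}"
  have "finite ?S" "?S \<noteq> {}" using up by auto
  then have "Min ?S \<in> ?S" and min: "\<And>x. x \<in> ?S \<Longrightarrow> Min ?S \<le> x" by (auto intro: Min_in)
  then obtain k where k: "Min ?S = l k" "k < u" "M j \<le> nmul N (l k)" by blast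
  have k3: "l k \<le> l k'" if "k' < u" "M j \<le> nmul N (l k')" for k'
    using min[of "l k'"] that unfolding k(1) by blast
  have "nmul N (l k) < M j + nmul N e" if "0 < e" for e
  proof (rule ccontr)
    assume "\<not> ?thesis"
    then have c: "M j \<le> nmul N (l k - e)" by (simp add: nmul_diff le_diff_eq)
    then have "z < l k - e" using less_le_trans[OF z(1) c] N_pos by (simp add: nmul_less_iff)
    from root_between[OF this _ z(1) c, of "l k"] that obtain k' where "k' < u" "z < l k'" "l k' < l k" by auto
    with z(2)[of k'] k3[of k'] show False by force
  qed
  with k show ?thesis by blast
qed

text \<open>For a simple root the left side of \<open>val_eq\<close> has second difference
  \<open>nmul N d\<close> at \<open>l k\<close> for small \<open>d\<close>. A vertex whose mean is
  exactly \<open>l k\<close> already contributes this amount on the right, while every vertex on the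
  cycle of \<open>j\<close> contributes something positive. So \<open>j\<close> and
  \<open>\<sigma> j\<close> both equal that vertex.\<close>

lemma multiplicity:
  assumes k: "k < u" and j: "M j \<le> nmul N (l k)" "\<And>e. 0 < e \<Longrightarrow> nmul N (l k) < M j + nmul N e"
  shows "2 \<le> t k \<or> t k = 1 \<and> \<sigma> j = j \<and> M j = nmul N (l k)"
proof (cases "t k = 1")
  case False
  with t_pos[OF k] show ?thesis by auto
next
  case t1: True
  \<comment> \<open>The step \<open>d\<close> is the distance from \<open>l k\<close> to the nearest
    other root, capped by \<open>e\<^sub>0\<close>.\<close>
  define D where "D = insert e\<^sub>0 ((\<lambda>k'. max (l k' - l k) (l k - l k')) ` ({..<u} - {k}))"
  define d where "d = Min D"
  have fin: "finite D" by (simp add: D_def)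
  have "0 < max (l k' - l k) (l k - l k')" if "k' < u" "k' \<noteq> k" for k'
  proof -
    have "l k' \<noteq> l k" using inj_onD[OF l_inj, of k' k] that k by auto
    then show ?thesis by (cases "l k' < l k") (auto simp: less_max_iff_disj)
  qed
  then have d: "0 < d" unfolding d_def using fin e0
    by (subst Min_gr_iff) (auto simp: D_def)
  have sep: "l k' + d \<le> l k \<or> l k + d \<le> l k'" if "k' < u" "k' \<noteq> k" for k'
  proof -
    have "d \<le> max (l k' - l k) (l k - l k')" unfolding d_def using fin that by (intro Min_le) (auto simp: D_def)
    then show ?thesis by (auto simp: le_max_iff_disj le_diff_eq add.commute)
  qed
  let ?x = "l k"
  define \<delta> where "\<delta> x d m = max (x + d) m - max x m - (max x m - max (x - d) m)" for x d m :: 'a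
  have "(\<Sum>i\<in>UNIV. \<delta> (nmul N ?x) (nmul N d) (M i)) = (\<Sum>k'<u. nmul (N * t k') (\<delta> ?x d (l k')))"
  proof -
    let ?G = "\<lambda>a. \<Sum>k<u. nmul (N * t k) (max a (l k))"
    have "(\<Sum>i\<in>UNIV. \<delta> (nmul N ?x) (nmul N d) (M i)) = ?G (?x + d) - ?G ?x - (?G ?x - ?G (?x - d))"
      unfolding \<delta>_def nmul_add[symmetric] nmul_diff[symmetric] sum_subtractf val_eq ..
    also have "\<dots> = (\<Sum>k'<u. nmul (N * t k') (\<delta> ?x d (l k')))"
      by (simp only: \<delta>_def nmul_diff sum_subtractf)
    finally show ?thesis .
  qed
  also have "\<dots> = (\<Sum>k'<u. if k' = k then nmul N d else 0)"
  proof (rule sum.cong[OF refl])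
    fix k' assume "k' \<in> {..<u}"
    then show "nmul (N * t k') (\<delta> ?x d (l k')) = (if k' = k then nmul N d else 0)"
      using sep[of k'] max_second_difference(3,4)[OF d, of "l k'" ?x, folded \<delta>_def]
        max_second_difference(5)[OF d, of ?x "l k'", folded \<delta>_def] t1 by auto
  qed
  also have "\<dots> = nmul N d" using k by simp
  finally have tot: "(\<Sum>i\<in>UNIV. \<delta> (nmul N ?x) (nmul N d) (M i)) = nmul N d" .
  have Nd: "0 < nmul N d" using d N_pos by (rule nmul_pos)
  note \<delta> = max_second_difference[OF Nd, folded \<delta>_def]
  obtain i where i: "M i = nmul N ?x" using root[OF k] by blast
  have uniq: "i' = i" if "M i' = M j" for i'
  proof (rule ccontr)
    assume ne: "i' \<noteq> i"
    let ?D = "\<lambda>i. \<delta> (nmul N ?x) (nmul N d) (M i)"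
    have "?D i' \<le> sum ?D (UNIV - {i})"
      using ne \<delta>(1) by (subst sum.remove[of _ i']) (auto intro: sum_nonneg)
    moreover have "0 < ?D i'" using \<delta>(2)[of "M i'" "nmul N ?x"] j that d by simp
    moreover have "?D i = nmul N d" using \<delta>(3) i by simp
    moreover have "sum ?D UNIV = ?D i + sum ?D (UNIV - {i})" by (simp add: sum.remove)
    ultimately show False using tot by simp
  qed
  from uniq[of j] uniq[of "\<sigma> j"] M_perm[of j] i t1 show ?thesis by auto
qed

end

section \<open>Images of the primary factors\<close>

lemma smat_vec_add_scal:
  "smat_vec (smat_add A (smat_scal c)) v = (\<lambda>i. smat_vec A v i + c * v i)"
  by (simp add: smat_vec_def smat_add_def smat_scal_def distrib_right sum.distrib
      if_distrib[of "\<lambda>x. x * _"] cong: if_cong)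

lemma smat_vec_lincomb:
  "smat_vec A (\<lambda>i. x i + c * z i) = (\<lambda>i. smat_vec A x i + c * smat_vec A z i)"
  by (simp add: smat_vec_def distrib_left sum.distrib sum_distrib_left mult.left_commute)

lemma smat_vec_scale: "smat_vec A (\<lambda>i. c * z i) = (\<lambda>i. c * smat_vec A z i)"
  by (simp add: smat_vec_def sum_distrib_left mult.left_commute)

lemma smat_vec_mult: "smat_vec (smat_mult X Y) v = smat_vec X (smat_vec Y v)"
  unfolding smat_vec_def smat_mult_def sum_distrib_left sum_distrib_right mult.assoc
  by (subst sum.swap) (rule refl)

lemma smat_vec_pow: "smat_vec (smat_pow X n) v = (smat_vec X ^^ n) v"
proof (induction n arbitrary: v)
  case 0
  show ?case by (simp add: smat_vec_def smat_id_def if_distrib[of "\<lambda>x. x * _"] cong: if_cong)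
next
  case (Suc n)
  then show ?case by (simp add: smat_vec_mult funpow_swap1)
qed

lemma smat_vec_add_scal_commute:
  "smat_vec (smat_add A (smat_scal c)) (smat_vec (smat_add A (smat_scal d)) v) =
   smat_vec (smat_add A (smat_scal d)) (smat_vec (smat_add A (smat_scal c)) v)"
  by (simp add: smat_vec_add_scal smat_vec_lincomb distrib_left ac_simps)

lemma funpow_commute:
  assumes "\<And>x. f (g x) = g (f x)"
  shows "(f ^^ m) ((g ^^ n) x) = (g ^^ n) ((f ^^ m) x)"
proof -
  have 1: "f ((g ^^ n) x) = (g ^^ n) (f x)" for x by (induction n) (simp_all add: assms)
  show ?thesis by (induction m) (simp_all add: 1)
qed

lemma smat_vec_primary_commute:
  "smat_vec (primary_at A c m) (smat_vec (primary_at A d n) v) =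
   smat_vec (primary_at A d n) (smat_vec (primary_at A c m) v)"
  unfolding primary_at_def smat_vec_pow
  by (rule funpow_commute) (rule smat_vec_add_scal_commute)

text \<open>The primary factors are polynomials in \<open>A\<close> and commute, so any of them can
  be moved to the front. Thus V'_i lies in the image of the factor of each root other than the
  i-th.\<close>

lemma smat_prod_list_primary_factor:
  assumes "k \<in> set ks"
  shows "\<exists>v'. smat_vec (smat_prod_list (map (\<lambda>j. primary_at A (lam j) (t j)) ks)) v =
    smat_vec (primary_at A (lam k) (t k)) v'"
  using assms
proof (induction ks)
  case (Cons x ks)
  have eq: "smat_vec (smat_prod_list (map (\<lambda>j. primary_at A (lam j) (t j)) (x # ks))) v =
    smat_vec (primary_at A (lam x) (t x)) (smat_vec (smat_prod_list (map (\<lambda>j. primary_at A (lam j) (t j)) ks)) v)"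
    by (simp add: smat_prod_list_def smat_vec_mult)
  show ?case
  proof (cases "k = x")
    case True
    with eq show ?thesis by blast
  next
    case False
    with Cons obtain v' where "smat_vec (smat_prod_list (map (\<lambda>j. primary_at A (lam j) (t j)) ks)) v =
      smat_vec (primary_at A (lam k) (t k)) v'" by auto
    then show ?thesis unfolding eq by (metis smat_vec_primary_commute)
  qed
qed simp

lemma val_smat_vec_ge:
  fixes A :: "('a::linordered_ab_group_add, 'n::finite) smat"
  assumes "A i k \<noteq> 0" "v k \<noteq> 0"
  shows "smat_vec A v i \<noteq> 0" "val (A i k) + val (v k) \<le> val (smat_vec A v i)"
  using val_sum_ge[of UNIV k "\<lambda>k. A i k * v k"] assms by (auto simp: smat_vec_def val_mult)

context dominant_permutation
begin

abbreviation shift :: "'a \<Rightarrow> ('a, 'n) svec \<Rightarrow> ('a, 'n) svec" where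
  "shift x \<equiv> smat_vec (smat_add A (smat_scal (Tan x)))"

lemma shift_apply: "shift x v i = smat_vec A v i + Tan x * v i"
  by (simp add: smat_vec_add_scal)

lemma shift_ge:
  assumes "v i \<noteq> 0"
  shows "shift x v i \<noteq> 0" "x + val (v i) \<le> val (shift x v i)"
  using val_add_ge[of "Tan x * v i" "smat_vec A v i"] assms
  by (auto simp: shift_apply val_mult add.commute)

lemma shift_ge_entry:
  assumes "A i k \<noteq> 0" "v k \<noteq> 0"
  shows "shift x v i \<noteq> 0" "val (A i k) + val (v k) \<le> val (shift x v i)"
  using val_smat_vec_ge[of A i k v] val_add_ge[of "smat_vec A v i" "Tan x * v i"] assms
  by (auto simp: shift_apply intro: order_trans)

lemma shift_bound:
  assumes "\<And>i. shift x v i \<noteq> 0 \<Longrightarrow> nmul N (val (shift x v i)) \<le> m + y i" "v i \<noteq> 0"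
  shows "nmul N x + nmul N (val (v i)) \<le> m + y i"
  using order_trans[OF nmul_mono[OF shift_ge(2)[of v i x, OF assms(2)]] assms(1)] shift_ge(1)[of v i x, OF assms(2)]
  by (simp add: nmul_add)

text \<open>Maximal coordinates are traced back through one factor. A maximal entry at
  \<open>j\<close> comes from \<open>x\<close> times \<open>v j\<close> or from some
  \<open>A j k * v k\<close>; by \<open>slack\<close> and \<open>M j \<le> nmul N x\<close>, any
  \<open>k\<close> other than \<open>\<sigma> j\<close> would push \<open>v k\<close> above its
  bound.\<close>

lemma shift_max:
  assumes bnd: "\<And>i. shift x v i \<noteq> 0 \<Longrightarrow> nmul N (val (shift x v i)) \<le> m + y i"
    and j: "shift x v j \<noteq> 0" "nmul N (val (shift x v j)) = m + y j" and M: "M j \<le> nmul N x"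
  shows "\<exists>i\<in>{j, \<sigma> j}. v i \<noteq> 0 \<and> nmul N x + nmul N (val (v i)) = m + y i"
proof (cases "v j \<noteq> 0 \<and> nmul N x + nmul N (val (v j)) = m + y j")
  case True
  then show ?thesis by blast
next
  case False
  let ?X = "smat_vec A v j" and ?Y = "Tan x * v j"
  have Y: "?Y = 0 \<or> val ?Y \<noteq> val (?X + ?Y)"
    using False j(2) by (auto simp: val_mult nmul_add[symmetric] shift_apply)
  then have X: "?X \<noteq> 0 \<and> val ?X = val (?X + ?Y)"
    using j(1) val_add[of ?X ?Y] unfolding shift_apply
    by (cases "?X = 0"; cases "?Y = 0") (auto simp: max_def split: if_splits)
  then obtain k where k: "A j k * v k \<noteq> 0" "val (A j k * v k) = val ?X"
    using sum_attained[of UNIV "\<lambda>k. A j k * v k"] by (auto simp: smat_vec_def)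
  then have eq: "nmul N (val (A j k)) + nmul N (val (v k)) = m + y j"
    using X j(2) by (simp add: shift_apply val_mult nmul_add[symmetric])
  have vk: "v k \<noteq> 0" "A j k \<noteq> 0" using k by auto
  have le: "nmul N x + nmul N (val (v k)) \<le> m + y k" by (rule shift_bound[OF bnd vk(1)])
  have le2: "M j + nmul N (val (v k)) \<le> nmul N x + nmul N (val (v k))" using M by simp
  have "m + y k + (M j + y j) = (m + y j) + (M j + y k)" by (simp add: ac_simps)
  also have "\<dots> = (nmul N (val (A j k)) + y k) + (M j + nmul N (val (v k)))"
    unfolding eq[symmetric] by (simp add: ac_simps)
  finally have m: "m + y k + (M j + y j) = (nmul N (val (A j k)) + y k) + (M j + nmul N (val (v k)))" .
  have "k = \<sigma> j"
  proof (rule ccontr)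
    assume "k \<noteq> \<sigma> j"
    then have "m + y k + (M j + y j) < (M j + y j) + (M j + nmul N (val (v k)))"
      unfolding m using slack[OF vk(2)] by simp
    then have "m + y k < M j + nmul N (val (v k))" by (metis add.commute add_less_cancel_left)
    with le le2 show False by (meson leD order_trans)
  qed
  then have "m + y k + (M j + y j) = (M j + y j) + (M j + nmul N (val (v k)))"
    using m tight[of j] by simp
  then have "m + y k = M j + nmul N (val (v k))" by (metis add.commute add_left_cancel)
  with le le2 have "nmul N x + nmul N (val (v k)) = m + y k" by simp
  with vk \<open>k = \<sigma> j\<close> show ?thesis by blast
qed

text \<open>For \<open>n = 1\<close> the vertex \<open>j\<close> is a loop of weight
  \<open>x\<close>, and the two summands of A + x tie there. For larger \<open>n\<close> the two
  outer factors expand to A^2 + xA + xA + x^2, and the repeated mixed term produces a ghost. The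
  second condition in \<open>M\<close> covers groups that do not contain the exact cycle
  mean.\<close>

lemma not_tangible_shift_pow:
  assumes z: "z = (shift x ^^ n) v"
    and tan_z: "\<And>i. z i \<noteq> 0 \<Longrightarrow> tangible (z i)"
    and bnd: "\<And>i. z i \<noteq> 0 \<Longrightarrow> nmul N (val (z i)) \<le> m + y i"
    and j: "z j \<noteq> 0" "nmul N (val (z j)) = m + y j"
    and M: "M j \<le> nmul N x" "\<And>e. 0 < e \<Longrightarrow> nmul N x < M j + nmul N e"
    and n: "2 \<le> n \<or> n = 1 \<and> \<sigma> j = j \<and> M j = nmul N x"
  shows False
proof -
  have balanced: "\<not> tangible (shift x v i)"
    if "smat_vec A v i \<noteq> 0" "v i \<noteq> 0" "val (shift x v i) \<le> val (smat_vec A v i)"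
      "val (shift x v i) \<le> x + val (v i)" for v i
  proof
    assume t: "tangible (shift x v i)"
    have "Tan x * v i \<noteq> 0" using that by simp
    moreover have "val (Tan x * v i) = x + val (v i)" using that by (simp add: val_mult)
    ultimately show False
      using t that tangible_add[of "smat_vec A v i" "Tan x * v i"] val_add[of "smat_vec A v i" "Tan x * v i"]
      by (auto simp: shift_apply)
  qed
  from n show False
  proof
    assume n1: "n = 1 \<and> \<sigma> j = j \<and> M j = nmul N x"
    then have z1: "z = shift x v" using z by simp
    have v: "v j \<noteq> 0" "nmul N x + nmul N (val (v j)) = m + y j"
      using shift_max[of x v m j] bnd j M n1 unfolding z1 by auto
    have "nmul N (val (A j j)) = nmul N x" using tight[of j] n1 by simp
    then have ajj: "val (A j j) = x" using N_pos by (simp add: nmul_eq_iff)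
    have nz: "A j j \<noteq> 0" using tan[of j] n1 tangible_nonzero by auto
    have "nmul N (val (z j)) = nmul N (x + val (v j))" using v j by (simp add: nmul_add)
    then have "val (z j) = x + val (v j)" using N_pos by (simp add: nmul_eq_iff)
    then show False
      using balanced[of v j] val_smat_vec_ge[of A j j v] nz v tan_z[OF j(1)] ajj
      unfolding z1 by auto
  next
    assume "2 \<le> n"
    then obtain n' where n': "n = Suc (Suc n')" by (metis Suc_le_D numeral_2_eq_2 Suc_le_mono)
    define v3 where "v3 = (shift x ^^ n') v"
    define v2 where "v2 = shift x v3"
    have z2: "z = shift x v2" using z n' by (simp add: v2_def v3_def)
    \<comment> \<open>Since \<open>z\<close> is at least \<open>x\<close> times \<open>v2\<close>,
      the bound for \<open>z\<close> lowered by \<open>nmul N x\<close> bounds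
      \<open>v2\<close>.\<close>
    define m2 where "m2 = m - nmul N x"
    have bnd2: "nmul N (val (v2 i)) \<le> m2 + y i" if "v2 i \<noteq> 0" for i
      using shift_bound[of x v2 m i] bnd that unfolding z2 m2_def by (simp add: algebra_simps)
    obtain i2 where i2: "i2 \<in> {j, \<sigma> j}" "v2 i2 \<noteq> 0" "nmul N x + nmul N (val (v2 i2)) = m + y i2"
      using shift_max[of x v2 m j] bnd j M(1) unfolding z2 by blast
    have M2: "M i2 = M j" using i2(1) M_perm by auto
    have "nmul N (val (v2 i2)) = m2 + y i2" using i2(3) by (simp add: m2_def algebra_simps)
    then obtain i3 where i3: "i3 \<in> {i2, \<sigma> i2}" "v3 i3 \<noteq> 0" "nmul N x + nmul N (val (v3 i3)) = m2 + y i3"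
      using shift_max[of x v3 m2 i2] bnd2 i2(2) M(1) M2 unfolding v2_def by auto
    have M3: "M i3 = M j" using i3(1) M_perm M2 by auto
    \<comment> \<open>At \<open>q\<close> the two copies of the mixed term \<open>x A v3\<close> are too close to the maximum to be exceeded.\<close>
    define q where "q = inv \<sigma> i3"
    have q: "\<sigma> q = i3" using permutes_inverses(1)[OF perm] by (simp add: q_def)
    have Mq: "M q = M j" using M_perm[of q] q M3 by simp
    have nz: "A q i3 \<noteq> 0" using tan[of q] q tangible_nonzero by auto
    define \<theta> where "\<theta> = x + (val (A q i3) + val (v3 i3))"
    have "nmul N \<theta> + nmul N x + y i3 = (nmul N (val (A q i3)) + y i3) + (nmul N x + nmul N (val (v3 i3))) + nmul N x"
      by (simp add: \<theta>_def nmul_add algebra_simps)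
    also have "\<dots> = (M j + y q) + (m2 + y i3) + nmul N x"
      using tight[of q] q Mq i3(3) by simp
    also have "\<dots> = M j + y q + m + y i3" by (simp add: m2_def algebra_simps)
    finally have \<theta>: "nmul N \<theta> + nmul N x = M j + (m + y q)" by (simp add: algebra_simps)
    have a: "v2 q \<noteq> 0" "val (A q i3) + val (v3 i3) \<le> val (v2 q)"
      using shift_ge_entry[of q i3 v3 x] nz i3 by (auto simp: v2_def)
    have b: "v2 i3 \<noteq> 0" "x + val (v3 i3) \<le> val (v2 i3)"
      using shift_ge[of v3 i3 x] i3 by (auto simp: v2_def)
    have X: "smat_vec A v2 q \<noteq> 0" "\<theta> \<le> val (smat_vec A v2 q)"
    proof -
      have "\<theta> = val (A q i3) + (x + val (v3 i3))" by (simp add: \<theta>_def ac_simps)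
      also have "\<dots> \<le> val (A q i3) + val (v2 i3)" using b(2) by simp
      also have "\<dots> \<le> val (smat_vec A v2 q)" by (rule val_smat_vec_ge(2)[of A q i3 v2, OF nz b(1)])
      finally show "\<theta> \<le> val (smat_vec A v2 q)" .
    qed (rule val_smat_vec_ge(1)[of A q i3 v2, OF nz b(1)])
    have Y: "\<theta> \<le> x + val (v2 q)" using a(2) by (simp add: \<theta>_def)
    have zq: "z q \<noteq> 0" using shift_ge(1)[of v2 q x] a by (simp add: z2)
    have "val (z q) \<le> \<theta>"
    proof (rule ccontr)
      assume "\<not> ?thesis"
      \<comment> \<open>The normalised value of \<theta> misses the bound by
        \<open>nmul N x - M j\<close>; the excess of \<open>z q\<close> over \<theta>, used as
        \<open>e\<close>, would break that bound.\<close>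
      then have "0 < val (z q) - \<theta>" by simp
      from M(2)[OF this] have "nmul N \<theta> + nmul N x < M j + nmul N (val (z q))"
        by (simp add: nmul_diff algebra_simps)
      then show False unfolding \<theta> using bnd[OF zq] by simp
    qed
    then show False using balanced[of v2 q] X Y a(1) tan_z[OF zq] unfolding z2 by (meson order_trans)
  qed
qed

end

text \<open>This excludes the empty product of primary factors. If the value were 1, the identity
  would attain the determinant with tangible diagonal entries; as these contain the ghost unit as a
  summand, their values would be positive, and so would that of their product. At the tangible unit
  the zero matrix is a counterexample.\<close>

lemma charpoly_not_constant_1:
  fixes A :: "('a::linordered_ab_group_add, 'n::finite) smat"
  shows "charpoly_fun A (Gh 0) \<noteq> 1"
proof
  assume f: "charpoly_fun A (Gh 0) = 1"
  define X where "X = smat_add (smat_scal (Gh 0)) A"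
  have Xd: "X j j = Gh 0 + A j j" for j by (simp add: X_def smat_add_def smat_scal_def)
  have gh: "Gh 0 \<noteq> (0::'a st)" "\<not> tangible (Gh (0::'a))" by (simp_all add: zero_st_def tangible_def)
  have d: "X j j \<noteq> 0" "0 \<le> val (X j j)" for j
    using val_add_ge[OF gh(1), of "A j j"] gh by (auto simp: Xd)
  have id: "id permutes (UNIV::'n set)" by (rule permutes_id)
  have s: "sdet X = 1" using f by (simp add: charpoly_fun_def X_def)
  have sum: "(\<Sum>j\<in>UNIV. val (X j (id j))) = val (sdet X)"
    using sdet_term_ge(2)[of id X, OF id] d s sum_nonneg[of UNIV "\<lambda>j. val (X j j)"] by (simp add: antisym)
  have t: "tangible (X j j)" for j
    using tangible_sdet_term(1)[of X id j, OF _ id] d s sum by simp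
  have pos: "0 < val (X j j)" for j
    using t[of j] gh tangible_add[of "Gh 0" "A j j"] val_add[of "Gh 0" "A j j"]
    by (cases "A j j = 0") (auto simp: Xd)
  have "0 < (\<Sum>j\<in>UNIV. val (X j j))" using pos by (intro sum_pos) auto
  then show False using sum s by simp
qed

section \<open>Independence of the subspaces\<close>

theorem theorem3p14:
  fixes A :: "('a::linordered_ab_group_add, 'n::finite) smat"
    and u :: nat and lam :: "nat \<Rightarrow> 'a st" and t :: "nat \<Rightarrow> nat"
  assumes "strongly_nonsingular A"
    and "\<forall>x. charpoly_fun A x = (\<Prod>i<u. (x + lam i) ^ t i)"
    and "\<forall>i<u. 0 < t i"
    and "inj_on lam {..<u}"
  shows "st_independent_subspaces u
           (\<lambda>i. smat_image (smat_prod_list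
                   (map (\<lambda>j. primary_at A (lam j) (t j)) (filter (\<lambda>j. j \<noteq> i) [0..<u]))))"
  unfolding st_independent_subspaces_def
proof
  let ?h = "\<lambda>i. smat_prod_list (map (\<lambda>j. primary_at A (lam j) (t j)) (filter (\<lambda>j. j \<noteq> i) [0..<u]))"
  assume "st_dependent_subspaces u (\<lambda>i. smat_image (?h i))"
  then obtain w a where w: "\<And>i. i < u \<Longrightarrow> tangible_vec (w i)" "\<And>i. i < u \<Longrightarrow> w i \<in> smat_image (?h i)"
    and a: "\<And>i. i < u \<Longrightarrow> tangible (a i)" and dep: "\<And>c. \<not> tangible (\<Sum>i<u. a i * w i c)"
    unfolding st_dependent_subspaces_def st_dependent_vecs_def ghost_or_zero_iff by blast
  define z where "z i c = a i * w i c" for i c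
  have z_tan: "tangible (z i c)" if "i < u" "z i c \<noteq> 0" for i c
    using w(1)[OF that(1)] a[OF that(1)] that(2)
    by (auto simp: z_def tangible_vec_def Zero_eq_0)
  have z_ne: "\<exists>c. z i c \<noteq> 0" if "i < u" for i
    using w(1)[OF that] a[OF that] tangible_nonzero by (fastforce simp: z_def tangible_vec_def Zero_eq_0)
  have z_im: "\<exists>v. z i = smat_vec (?h i) v" if iu: "i < u" for i
  proof -
    obtain v where "w i = smat_vec (?h i) v" using w(2)[OF iu] by (auto simp: smat_image_def)
    then have "z i = smat_vec (?h i) (\<lambda>c. a i * v c)" by (simp add: smat_vec_scale z_def fun_eq_iff)
    then show ?thesis by blast
  qed
  \<comment> \<open>Where a sum of tangible or zero entries is not tangible, its largest value is
    not attained by one entry alone.\<close>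
  have other: "\<exists>k<u. k \<noteq> i \<and> z k c \<noteq> 0 \<and> val (z i c) \<le> val (z k c)" if "i < u" "z i c \<noteq> 0" for i c
  proof (rule ccontr)
    assume "\<not> ?thesis"
    then have "tangible (\<Sum>i<u. z i c)"
      using z_tan[OF that] that by (intro tangible_sumI[of _ i]) (auto simp: not_le)
    then show False using dep[of c] by (simp add: z_def)
  qed
  \<comment> \<open>At 0 this makes the roots tangible; at \<open>lam k\<close> it shows by
    contradiction that the characteristic polynomial is not tangible there.\<close>
  have factor_tan: "tangible (x + lam i)" if "tangible (charpoly_fun A x)" "i < u" for x i
  proof -
    have "\<forall>i\<in>{..<u}. tangible ((x + lam i) ^ t i)"
      using that(1) by (simp only: assms(2)[rule_format] tangible_prod finite_lessThan)
    then have "tangible ((x + lam i) ^ t i)" using that(2) by blast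
    then show ?thesis using assms(3)[rule_format, OF that(2)] by (simp add: tangible_pow)
  qed
  have lam_tan: "tangible (lam i)" if "i < u" for i
  proof -
    have "smat_add (smat_scal 0) A = A" by (auto simp: smat_add_def smat_scal_def fun_eq_iff)
    then have "tangible (charpoly_fun A 0)"
      using strongly_nonsingular_sdet[OF assms(1)] by (simp add: charpoly_fun_def)
    from factor_tan[OF this that] show ?thesis by simp
  qed
  define l where "l i = val (lam i)" for i
  have lam: "lam i = Tan (l i)" if "i < u" for i using tangible_Tan_val[OF lam_tan[OF that]] by (simp add: l_def)
  have l_inj: "inj_on l {..<u}" using assms(4) lam unfolding inj_on_def by (metis lessThan_iff)
  \<comment> \<open>The empty family counts as dependent, its sum being \<open>Zero\<close>, so this
    case has to be excluded separately.\<close>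
  have "u \<noteq> 0"
  proof
    assume "u = 0"
    then have "charpoly_fun A (Gh 0) = 1" using assms(2) by simp
    with charpoly_not_constant_1 show False by blast
  qed
  \<comment> \<open>A dependence of nonzero vectors involves at least two of them, and the
    difference of two distinct roots yields a positive group element.\<close>
  then obtain c where c: "0 < u" "z 0 c \<noteq> 0" using z_ne[of 0] by auto
  obtain k where k: "k < u" "k \<noteq> 0" using other[OF c] by blast
  have "l k \<noteq> l 0" using inj_onD[OF l_inj, of k 0] k c by auto
  then have "\<exists>e::'a. 0 < e"
    by (cases "l k < l 0") (auto intro: exI[of _ "l 0 - l k"] exI[of _ "l k - l 0"])
  then obtain e\<^sub>0 :: 'a where e0: "0 < e\<^sub>0" by blast
  obtain \<sigma> N M y where dp: "dominant_permutation A \<sigma> N M y"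
    using exists_dominant_permutation[OF assms(1) e0] by blast
  interpret dominant_permutation A \<sigma> N M y by (rule dp)
  interpret root_factorization A \<sigma> N M y u l t e\<^sub>0
  proof
    show "0 < e\<^sub>0" by (rule e0)
    show "0 < t k" if "k < u" for k using assms(3) that by blast
    show "inj_on l {..<u}" by (rule l_inj)
    have nz: "Tan x + lam i \<noteq> 0" for x i by simp
    have "val (charpoly_fun A (Tan x)) = (\<Sum>k<u. nmul (t k) (max x (l k)))" for x
      using assms(2) lam nz by (simp add: val_prod val_pow st_pow_eq_0 val_add)
    then show "(\<Sum>k<u. nmul (N * t k) (max x (l k))) = (\<Sum>j\<in>UNIV. max (nmul N x) (M j))" for x
      using charpoly_Tan(2)[of x] by (simp add: nmul_sum nmul_mult)
    show "\<exists>j. M j = nmul N (l k)" if "k < u" for k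
    proof (rule ccontr)
      assume "\<not> ?thesis"
      then have "tangible (charpoly_fun A (Tan (l k)))" using charpoly_Tan(3) by blast
      from factor_tan[OF this that] show False by (simp add: lam[OF that] tangible_add)
    qed
  qed
  let ?S = "{(i, c). i < u \<and> z i c \<noteq> 0}" and ?f = "\<lambda>(i, c). nmul N (val (z i c)) - y c"
  have fin: "finite ?S" by (rule finite_subset[of _ "{..<u} \<times> UNIV"]) auto
  have "?S \<noteq> {}" using c by auto
  with fin have "Max (?f ` ?S) \<in> ?f ` ?S" by (intro Max_in) auto
  then obtain i j where ij: "i < u" "z i j \<noteq> 0" "nmul N (val (z i j)) - y j = Max (?f ` ?S)" by auto
  define m where "m = nmul N (val (z i j)) - y j"
  have max: "nmul N (val (z k c)) \<le> m + y c" if "k < u" "z k c \<noteq> 0" for k c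
  proof -
    have "?f (k, c) \<le> Max (?f ` ?S)" using fin that by (intro Max_ge finite_imageI imageI) auto
    then show ?thesis unfolding m_def ij(3) by (simp add: diff_le_eq)
  qed
  obtain i' where i': "i' < u" "i' \<noteq> i" "z i' j \<noteq> 0" "val (z i j) \<le> val (z i' j)"
    using other[OF ij(1,2)] by blast
  have m: "nmul N (val (z i j)) = m + y j" by (simp add: m_def)
  then have m': "nmul N (val (z i' j)) = m + y j"
    using max[OF i'(1,3)] nmul_mono[OF i'(4), of N] by simp
  obtain k where k: "k < u" "M j \<le> nmul N (l k)" "\<And>e. 0 < e \<Longrightarrow> nmul N (l k) < M j + nmul N e"
    using exists_root_above[of j] by blast
  have contra: False if i: "i < u" "i \<noteq> k" "z i j \<noteq> 0" "nmul N (val (z i j)) = m + y j" for i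
  proof -
    obtain v where "z i = smat_vec (?h i) v" using z_im[OF i(1)] by blast
    moreover have "k \<in> set (filter (\<lambda>j. j \<noteq> i) [0..<u])" using k i by auto
    ultimately obtain v' where "z i = smat_vec (primary_at A (lam k) (t k)) v'"
      using smat_prod_list_primary_factor[of k _ A lam t v] by metis
    then have "z i = (shift (l k) ^^ t k) v'"
      using lam[OF k(1)] by (simp add: primary_at_def smat_vec_pow)
    from not_tangible_shift_pow[OF this _ _ i(3,4) k(2,3) multiplicity[OF k]] z_tan[OF i(1)] max[OF i(1)]
    show False by blast
  qed
  \<comment> \<open>As \<open>i\<close> and \<open>i'\<close> differ, at least one of them is not
    \<open>k\<close>, and its vector lies in the image of the factor of
    \<open>lam k\<close>.\<close>
  show False using contra[OF ij(1) _ ij(2) m] contra[OF i'(1) _ i'(3) m'] i'(2) by blast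
qed

end
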